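(* Let $A=(B,O,S)$ be an abduction instance and let $G$ be a proof graph of a hypothesis $H\in\hat{\mathcal H}(A)$. Then there is a proof graph $G'$ and a hypothesis $H'\in\hat{\mathcal H}(A)$ (with $G'$ a proof graph wrt. $H'$) such that $G$ and $G'$ have the same cost with respect to each of the objective functions $\mathrm{CARD}$, $\mathrm{COH}$ and $\mathrm{WA}$, and such that factoring in $G'$ is only performed with atoms in $A(G')$.
   Context: **Abduction instances.** An abduction instance is a tuple $A=(B,O,S)$. Here $O$ (observation, goal) is an existentially quantified conjunction of atoms, also regarded as a set of atoms, whose existential variables are represented by constants not in $S$. $B$ is a finite set of axioms, each a single-head Horn clause $$q(Y_1,\dots,Y_m)\Leftarrow p_1(X^1_1,\dots,X^1_{k_1})\wedge\cdots\wedge p_r(X^r_1,\dots,X^r_{k_r}),$$ with all head variables occurring in the body, universally quantified (constants may also occur as arguments). $S$ is a set of constants of $B$ called sort names. $B$ is assumed acyclic: no circular inferences are possible over the axioms. **Hypotheses.** A hypothesis is a conjunction of atoms and equalities between terms. The set $\hat{\mathcal H}(A)$ of all hypotheses of $A$ is obtained from $\{O\}$ by closing under two operations. *Back-chaining*: given an atom $P$ in a hypothesis $H$ that unifies via $\theta$ with the head of an axiom, add the hypothesis $H\wedge P_1'\wedge\cdots\wedge P_r'$ with $P_i'=\theta(p_i(X^i_1,\dots,X^i_{k_i}))$, where body variables not in the head are existential and are replaced by Skolem terms (value invention). *Unification*: given distinct atoms $P,Q\in H$ unifying under $\theta$ such that all $X\mapsto Y\in\theta$ obey $X,Y\notin S$,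 add $H\wedge\bigwedge\{X=Y\mid X\mapsto Y\in\theta\}$. **Proof graphs.** A proof graph $G$ wrt. $H\in\hat{\mathcal H}(A)$ is an acyclic directed graph with nodes $N(G)=\{P\in H\mid P\text{ is not an equality}\}$ and edges $E(G)$ defined by the inference operations used to generate the atoms of $H$: back-chaining of $P$ induces an edge from each body atom $P_i'$ to $P$; unification of $P$ with $Q$ induces either an edge from $P$ to $Q$ or an edge from $Q$ to $P$. A unification edge $(P,Q)$ from $P$ to $Q$ is called a factoring edge, and we say that $Q$ is factored with $P$. Only hypotheses and proof graphs are considered where each atom is justified by a single inference (back-chaining), or by a single factoring, or not at all (then it is abduced). Let $A(G)=\{a\in N(G)\mid\nexists b:(b,a)\in E(G)\}$, the set of abduced atoms. Factoring is only performed with atoms in $A(G)$ if every factoring edge $(P,Q)$ has $P\in A(G)$. **Objective functions.** For a proof graph $G$: - $\mathrm{CARD}(G)=|A(G)|$ (cardinality). - $\mathrm{COH}(G)=|\{(a,b)\mid a,b\in O,\ a<b,\text{ and }\nexists n\in N(G)\text{ such that from }n\text{ we can reach both }a\text{ and }b\text{ in }G\}|$ (coherence), where $<$ is an arbitrary fixed total order on $O$. - $\mathrm{WA}(G)=\sum_{a\in A(G)}\min cost(a)$ (weighted abduction), where each axiom has weights $w_1,\dots,w_r$ for its body atoms, each $o\in O$ has an initial cost $ic(o)$, and $cost:N(G)\to2^{\mathbb R}$ is initialized with $\emptyset$ and recursively defined: (i) each $o\in O$ obtains $ic(o)$ as an element of $cost(o)$; (ii) if $P$ was back-chained with an axiom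 with body atoms $P_1',\dots,P_r'$ and $c=\min cost(P)$, then $c\cdot w_i$ is added to $cost(P_i')$ for $1\le i\le r$; (iii) if there is a factoring edge $(Q,P)$ from $Q$ to $P$, then $\min cost(P)$ is added to $cost(Q)$.
   Formalization: The weights are assumed nonnegative (the claim for WA fails for negative weights); equal atoms introduced by different inferences count as distinct nodes; and the restriction that sort names are not identified with other terms is also imposed on unification with axiom heads in back-chaining. *)

theory Defs
  imports Complex_Main
begin

text \<open>
  The arguments of atoms are rule variables, constants and Skolem terms. The Skolem function symbol
  belonging to an existential body variable \<open>y\<close> of an axiom \<open>ax\<close> is the pair \<open>(ax, y)\<close>, which is
  why the three types are mutually recursive. Axioms contain only variables and constants,
  hypotheses only constants (among them those that stand for the existential variables of the
  observation) and Skolem terms.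
\<close>

datatype ('p, 'v, 'c) trm =
    Var 'v
  | Const 'c
  | Skolem "('p, 'v, 'c) axm" 'v "('p, 'v, 'c) trm list"
and ('p, 'v, 'c) atm = Atom (rel: 'p) (args: "('p, 'v, 'c) trm list")
and ('p, 'v, 'c) axm = Axiom (head: "('p, 'v, 'c) atm") (body: "('p, 'v, 'c) atm list")

abbreviation is_Var :: "('p, 'v, 'c) trm \<Rightarrow> bool" where
  "is_Var t \<equiv> \<exists>v. t = Var v"

abbreviation is_Const :: "('p, 'v, 'c) trm \<Rightarrow> bool" where
  "is_Const t \<equiv> \<exists>c. t = Const c"

definition axm_atoms :: "('p, 'v, 'c) axm \<Rightarrow> ('p, 'v, 'c) atm set" where
  "axm_atoms ax = insert (head ax) (set (body ax))"

definition atm_vars :: "('p, 'v, 'c) atm \<Rightarrow> 'v set" where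
  "atm_vars P = {v. Var v \<in> set (args P)}"

definition axm_consts :: "('p, 'v, 'c) axm \<Rightarrow> 'c set" where
  "axm_consts ax = {c. \<exists>P \<in> axm_atoms ax. Const c \<in> set (args P)}"

definition horn_axiom :: "('p, 'v, 'c) axm \<Rightarrow> bool" where
  "horn_axiom ax \<longleftrightarrow>
     (\<forall>P \<in> axm_atoms ax. \<forall>t \<in> set (args P). is_Var t \<or> is_Const t) \<and>
     atm_vars (head ax) \<subseteq> (\<Union>P \<in> set (body ax). atm_vars P)"


text \<open>
  Unification treats every term, Skolem terms and constants included, as an opaque object that may
  be bound: in a hypothesis all of them stand for possibly unknown individuals. What may not be
  bound, or be the target of a binding, is a sort name. \<open>is_mgu\<close> is the usual characterisation of
  idempotent most general unifiers; it forces \<open>\<theta>\<close> to be the identity outside the terms of \<open>P\<close> and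
  \<open>Q\<close> and to map each class of identified terms to one of its members.
\<close>

definition unifier ::
  "(('p, 'v, 'c) trm \<Rightarrow> ('p, 'v, 'c) trm) \<Rightarrow> ('p, 'v, 'c) atm \<Rightarrow> ('p, 'v, 'c) atm \<Rightarrow> bool" where
  "unifier \<theta> P Q \<longleftrightarrow> rel P = rel Q \<and> map \<theta> (args P) = map \<theta> (args Q)"

definition is_mgu ::
  "(('p, 'v, 'c) trm \<Rightarrow> ('p, 'v, 'c) trm) \<Rightarrow> ('p, 'v, 'c) atm \<Rightarrow> ('p, 'v, 'c) atm \<Rightarrow> bool" where
  "is_mgu \<theta> P Q \<longleftrightarrow> unifier \<theta> P Q \<and> (\<forall>\<sigma>. unifier \<sigma> P Q \<longrightarrow> \<sigma> \<circ> \<theta> = \<sigma>)"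

text \<open>
  Unification of a (variable-free) atom of a hypothesis with the head of an axiom. Rule variables
  are bound to arbitrary terms, and never the other way round; bindings between two terms of the
  hypothesis or the axiom obey the same restriction on sort names as the unification of two atoms of
  a hypothesis.
\<close>

definition unifies_head ::
  "'c set \<Rightarrow> (('p, 'v, 'c) trm \<Rightarrow> ('p, 'v, 'c) trm) \<Rightarrow> ('p, 'v, 'c) atm \<Rightarrow> ('p, 'v, 'c) axm \<Rightarrow> bool" where
  "unifies_head S \<theta> P ax \<longleftrightarrow>
     is_mgu \<theta> P (head ax) \<and>
     (\<forall>X. \<not> is_Var X \<and> \<theta> X \<noteq> X \<longrightarrow> \<not> is_Var (\<theta> X) \<and> X \<notin> Const ` S \<and> \<theta> X \<notin> Const ` S)"

definition body_trm ::
  "('p, 'v, 'c) axm \<Rightarrow> (('p, 'v, 'c) trm \<Rightarrow> ('p, 'v, 'c) trm) \<Rightarrow> ('p, 'v, 'c) trm \<Rightarrow> ('p, 'v, 'c) trm" where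
  "body_trm ax \<theta> t =
     (case t of
        Var y \<Rightarrow> if y \<in> atm_vars (head ax) then \<theta> t else Skolem ax y (map \<theta> (args (head ax)))
      | _ \<Rightarrow> \<theta> t)"

definition body_inst ::
  "('p, 'v, 'c) axm \<Rightarrow> (('p, 'v, 'c) trm \<Rightarrow> ('p, 'v, 'c) trm) \<Rightarrow> ('p, 'v, 'c) atm list" where
  "body_inst ax \<theta> = map (\<lambda>P. Atom (rel P) (map (body_trm ax \<theta>) (args P))) (body ax)"


text \<open>
  \<open>ax1\<close> feeds \<open>ax2\<close> if back-chaining with \<open>ax2\<close> is possible on some instance of a body
  atom of \<open>ax1\<close>.
\<close>

definition feeds :: "'c set \<Rightarrow> ('p, 'v, 'c) axm \<Rightarrow> ('p, 'v, 'c) axm \<Rightarrow> bool" where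
  "feeds S ax1 ax2 \<longleftrightarrow>
     (\<exists>P \<in> set (body ax1). \<exists>\<rho> \<theta>. (\<forall>v. \<not> is_Var (\<rho> v)) \<and>
        unifies_head S \<theta>
          (Atom (rel P) (map (\<lambda>t. case t of Var v \<Rightarrow> \<rho> v | _ \<Rightarrow> t) (args P))) ax2)"

record ('p, 'v, 'c) abduction =
  axioms :: "('p, 'v, 'c) axm set"
  obs :: "('p, 'v, 'c) atm list"
  sorts :: "'c set"

definition abduction_instance :: "('p, 'v, 'c) abduction \<Rightarrow> bool" where
  "abduction_instance A \<longleftrightarrow>
     finite (axioms A) \<and>
     (\<forall>ax \<in> axioms A. horn_axiom ax) \<and>
     distinct (obs A) \<and>
     (\<forall>P \<in> set (obs A). \<forall>t \<in> set (args P). is_Const t) \<and>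
     sorts A \<subseteq> (\<Union>ax \<in> axioms A. axm_consts ax) \<and>
     acyclic {(ax1, ax2). ax1 \<in> axioms A \<and> ax2 \<in> axioms A \<and> feeds (sorts A) ax1 ax2}"


text \<open>
  A hypothesis is a conjunction. Its atoms are kept as a list, and an atom of the hypothesis is an
  occurrence in this list, represented by its position: the body atoms introduced by one inference
  are different from those introduced by another one, even when they coincide syntactically (they
  can then be unified by the empty substitution). The first \<open>length (obs A)\<close> positions are the atoms
  of the observation.
\<close>

record ('p, 'v, 'c) hypothesis =
  atoms :: "('p, 'v, 'c) atm list"
  eqs :: "(('p, 'v, 'c) trm \<times> ('p, 'v, 'c) trm) set"

definition initial_hyp :: "('p, 'v, 'c) abduction \<Rightarrow> ('p, 'v, 'c) hypothesis" where
  "initial_hyp A = \<lparr>atoms = obs A, eqs = {}\<rparr>"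

definition back_chain ::
  "('p, 'v, 'c) abduction \<Rightarrow> ('p, 'v, 'c) hypothesis \<Rightarrow> nat \<Rightarrow> ('p, 'v, 'c) axm \<Rightarrow>
   ('p, 'v, 'c) hypothesis \<Rightarrow> bool" where
  "back_chain A H i ax H' \<longleftrightarrow>
     i < length (atoms H) \<and> ax \<in> axioms A \<and>
     (\<exists>\<theta>. unifies_head (sorts A) \<theta> (atoms H ! i) ax \<and>
          H' = \<lparr>atoms = atoms H @ body_inst ax \<theta>, eqs = eqs H\<rparr>)"

definition unify ::
  "('p, 'v, 'c) abduction \<Rightarrow> ('p, 'v, 'c) hypothesis \<Rightarrow> nat \<Rightarrow> nat \<Rightarrow>
   ('p, 'v, 'c) hypothesis \<Rightarrow> bool" where
  "unify A H i j H' \<longleftrightarrow>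
     i < length (atoms H) \<and> j < length (atoms H) \<and> i \<noteq> j \<and>
     (\<exists>\<theta>. is_mgu \<theta> (atoms H ! i) (atoms H ! j) \<and>
          (\<forall>X. \<theta> X \<noteq> X \<longrightarrow> X \<notin> Const ` sorts A \<and> \<theta> X \<notin> Const ` sorts A) \<and>
          H' = \<lparr>atoms = atoms H, eqs = eqs H \<union> {(X, \<theta> X) | X. \<theta> X \<noteq> X}\<rparr>)"

inductive_set hypotheses :: "('p, 'v, 'c) abduction \<Rightarrow> ('p, 'v, 'c) hypothesis set"
  for A :: "('p, 'v, 'c) abduction" where
  initial: "initial_hyp A \<in> hypotheses A"
| back_chaining: "H \<in> hypotheses A \<Longrightarrow> back_chain A H i ax H' \<Longrightarrow> H' \<in> hypotheses A"
| unification: "H \<in> hypotheses A \<Longrightarrow> unify A H i j H' \<Longrightarrow> H' \<in> hypotheses A"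


text \<open>
  An element \<open>(P, ax, bs)\<close> of \<open>inferences\<close> records that \<open>P\<close> was back-chained with \<open>ax\<close>, and that
  \<open>bs\<close> are the resulting atoms, in the order of the body of \<open>ax\<close>. An element \<open>(P, Q)\<close> of
  \<open>factorings\<close> is a factoring edge from \<open>P\<close> to \<open>Q\<close>, that is, \<open>Q\<close> is factored with \<open>P\<close>.
\<close>

record ('p, 'v, 'c) pgraph =
  nodes :: "nat set"
  inferences :: "(nat \<times> ('p, 'v, 'c) axm \<times> nat list) set"
  factorings :: "(nat \<times> nat) set"

definition edges :: "('p, 'v, 'c) pgraph \<Rightarrow> (nat \<times> nat) set" where
  "edges G = {(b, P). \<exists>ax bs. (P, ax, bs) \<in> inferences G \<and> b \<in> set bs} \<union> factorings G"

text \<open>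
  \<open>generated A H I F\<close>: some sequence of operations that leads from the observation to \<open>H\<close> induces the
  inferences \<open>I\<close> and the factoring edges \<open>F\<close>. Since \<open>unify\<close> does not depend on the order of the two
  atoms, the last rule yields an edge in either direction.
\<close>

inductive generated ::
  "('p, 'v, 'c) abduction \<Rightarrow> ('p, 'v, 'c) hypothesis \<Rightarrow>
   (nat \<times> ('p, 'v, 'c) axm \<times> nat list) set \<Rightarrow> (nat \<times> nat) set \<Rightarrow> bool"
  for A :: "('p, 'v, 'c) abduction" where
  initial: "generated A (initial_hyp A) {} {}"
| back_chaining:
    "generated A H I F \<Longrightarrow> back_chain A H i ax H' \<Longrightarrow>
     generated A H' (insert (i, ax, [length (atoms H)..<length (atoms H')]) I) F"
| unification:
    "generated A H I F \<Longrightarrow> unify A H i j H' \<Longrightarrow> generated A H' I (insert (i, j) F)"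

definition singly_justified :: "('p, 'v, 'c) pgraph \<Rightarrow> bool" where
  "singly_justified G \<longleftrightarrow>
     (\<forall>Q x y. (Q, x) \<in> inferences G \<and> (Q, y) \<in> inferences G \<longrightarrow> x = y) \<and>
     (\<forall>Q P P'. (P, Q) \<in> factorings G \<and> (P', Q) \<in> factorings G \<longrightarrow> P = P') \<and>
     (\<forall>Q x P. \<not> ((Q, x) \<in> inferences G \<and> (P, Q) \<in> factorings G))"

definition proof_graph ::
  "('p, 'v, 'c) abduction \<Rightarrow> ('p, 'v, 'c) hypothesis \<Rightarrow> ('p, 'v, 'c) pgraph \<Rightarrow> bool" where
  "proof_graph A H G \<longleftrightarrow>
     nodes G = {..<length (atoms H)} \<and>
     generated A H (inferences G) (factorings G) \<and>
     acyclic (edges G) \<and>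
     singly_justified G"

definition abduced :: "('p, 'v, 'c) pgraph \<Rightarrow> nat set" where
  "abduced G = {a \<in> nodes G. \<nexists>b. (b, a) \<in> edges G}"

definition factors_only_with_abduced :: "('p, 'v, 'c) pgraph \<Rightarrow> bool" where
  "factors_only_with_abduced G \<longleftrightarrow> (\<forall>(P, Q) \<in> factorings G. P \<in> abduced G)"


definition CARD_obj :: "('p, 'v, 'c) pgraph \<Rightarrow> nat" where
  "CARD_obj G = card (abduced G)"

definition COH_obj ::
  "('p, 'v, 'c) abduction \<Rightarrow> (('p, 'v, 'c) atm \<times> ('p, 'v, 'c) atm) set \<Rightarrow>
   ('p, 'v, 'c) pgraph \<Rightarrow> nat" where
  "COH_obj A lt G =
     card {(a, b). a < length (obs A) \<and> b < length (obs A) \<and> (obs A ! a, obs A ! b) \<in> lt \<and>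
                   (\<nexists>n. n \<in> nodes G \<and> (n, a) \<in> (edges G)\<^sup>* \<and> (n, b) \<in> (edges G)\<^sup>*)}"

text \<open>
  The set of costs of an atom \<open>n\<close> is determined by the costs of the atoms to which \<open>n\<close> has an edge.
  The weight of the \<open>k\<close>-th body atom (counted from 0) of \<open>ax\<close> is \<open>w ax k\<close>.
\<close>

definition cost_step ::
  "('p, 'v, 'c) abduction \<Rightarrow> (('p, 'v, 'c) axm \<Rightarrow> nat \<Rightarrow> real) \<Rightarrow> (('p, 'v, 'c) atm \<Rightarrow> real) \<Rightarrow>
   ('p, 'v, 'c) pgraph \<Rightarrow> (nat \<Rightarrow> real set) \<Rightarrow> nat \<Rightarrow> real set" where
  "cost_step A w ic G f n =
     (if n < length (obs A) then {ic (obs A ! n)} else {}) \<union>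
     {Min (f P) * w ax k | P ax bs k. (P, ax, bs) \<in> inferences G \<and> k < length bs \<and> bs ! k = n} \<union>
     {Min (f P) | P. (n, P) \<in> factorings G}"

definition cost ::
  "('p, 'v, 'c) abduction \<Rightarrow> (('p, 'v, 'c) axm \<Rightarrow> nat \<Rightarrow> real) \<Rightarrow> (('p, 'v, 'c) atm \<Rightarrow> real) \<Rightarrow>
   ('p, 'v, 'c) pgraph \<Rightarrow> nat \<Rightarrow> real set" where
  "cost A w ic G = wfrec ((edges G)\<inverse>) (cost_step A w ic G)"

definition WA_obj ::
  "('p, 'v, 'c) abduction \<Rightarrow> (('p, 'v, 'c) axm \<Rightarrow> nat \<Rightarrow> real) \<Rightarrow> (('p, 'v, 'c) atm \<Rightarrow> real) \<Rightarrow>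
   ('p, 'v, 'c) pgraph \<Rightarrow> real" where
  "WA_obj A w ic G = (\<Sum>a \<in> abduced G. Min (cost A w ic G a))"

lemma generated_imp_hypothesis: "generated A H I F \<Longrightarrow> H \<in> hypotheses A"
  by (induction rule: generated.induct) (auto intro: hypotheses.intros)

lemma generated_finite: "generated A H I F \<Longrightarrow> finite I \<and> finite F"
  by (induction rule: generated.induct) auto

lemma cost_rec:
  assumes "proof_graph A H G"
  shows "cost A w ic G n = cost_step A w ic G (cost A w ic G) n"
proof -
  have fin: "finite (inferences G)" "finite (factorings G)"
    using assms generated_finite by (auto simp: proof_graph_def)
  have "edges G = (\<Union>(P, ax, bs) \<in> inferences G. set bs \<times> {P}) \<union> factorings G"
    by (fastforce simp: edges_def)
  with fin have "finite (edges G)" by auto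
  then have wf: "wf ((edges G)\<inverse>)"
    using assms by (simp add: proof_graph_def finite_acyclic_wf_converse)
  have "cost_step A w ic G (cut (cost A w ic G) ((edges G)\<inverse>) n) n =
        cost_step A w ic G (cost A w ic G) n"
  proof -
    have i: "cut (cost A w ic G) ((edges G)\<inverse>) n P = cost A w ic G P"
      if "(P, ax, bs) \<in> inferences G \<and> k < length bs \<and> bs ! k = n" for P ax bs k
      using that nth_mem[of k bs] by (intro cut_apply) (auto simp: edges_def)
    have f: "cut (cost A w ic G) ((edges G)\<inverse>) n P = cost A w ic G P"
      if "(n, P) \<in> factorings G" for P
      using that by (intro cut_apply) (auto simp: edges_def)
    have "{Min (cut (cost A w ic G) ((edges G)\<inverse>) n P) * w ax k | P ax bs k.
             (P, ax, bs) \<in> inferences G \<and> k < length bs \<and> bs ! k = n} =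
          {Min (cost A w ic G P) * w ax k | P ax bs k.
             (P, ax, bs) \<in> inferences G \<and> k < length bs \<and> bs ! k = n}"
      by (intro Collect_cong ex_cong1) (metis i)
    moreover have "{Min (cut (cost A w ic G) ((edges G)\<inverse>) n P) | P. (n, P) \<in> factorings G} =
                   {Min (cost A w ic G P) | P. (n, P) \<in> factorings G}"
      by (intro Collect_cong ex_cong1) (metis f)
    ultimately show ?thesis
      by (simp only: cost_step_def)
  qed
  then show ?thesis
    using wfrec[OF wf, of "cost_step A w ic G" n] by (simp add: cost_def)
qed

end

theory Submission
  imports Defs "HOL-Library.Multiset"
begin

text \<open>
  A factoring edge \<open>P \<rightarrow> Q\<close> whose source is not abduced is removed by treating \<open>Q\<close> as \<open>P\<close> is treated.
  If \<open>P\<close> is factored with \<open>R\<close>, factor \<open>Q\<close> with \<open>R\<close> instead. If \<open>P\<close> is back-chained with \<open>ax\<close>, then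
  back-chain \<open>Q\<close> with \<open>ax\<close> as well and factor each new body atom with the corresponding body atom of
  \<open>P\<close>. Two atoms unify iff they have the same predicate, the same arity and the same sort names
  at the same positions; this equivalence relation passes on to the body atoms, so all these
  operations are possible.

  The abduced atoms do not change. Up to contracting the new atoms, both replacements turn the edge
  \<open>P \<rightarrow> Q\<close> into edges \<open>x \<rightarrow> Q\<close> from the predecessors \<open>x\<close> of \<open>P\<close>, which keeps all costs except that of
  \<open>P\<close>, since \<open>u * min a b = min (u * a) (u * b)\<close> for \<open>u \<ge> 0\<close>. For a rank function that increases along
  edges, a factoring edge is replaced by edges whose sources have smaller ranks, so the process stops.
\<close>

section \<open>Compatibility of atoms on sort names, and unification\<close>

definition same_sorts ::
  "'c set \<Rightarrow> ('p, 'v, 'c) atm \<Rightarrow> ('p, 'v, 'c) atm \<Rightarrow> bool" where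
  "same_sorts S P Q \<longleftrightarrow> rel P = rel Q \<and>
     list_all2 (\<lambda>p q. \<forall>s \<in> S. p = Const s \<longleftrightarrow> q = Const s) (args P) (args Q)"

lemma same_sorts_sym: "same_sorts S P Q \<Longrightarrow> same_sorts S Q P"
  by (auto simp: same_sorts_def list_all2_conv_all_nth)

lemma same_sorts_trans: "same_sorts S P Q \<Longrightarrow> same_sorts S Q R \<Longrightarrow> same_sorts S P R"
  by (auto simp: same_sorts_def list_all2_conv_all_nth)

text \<open>
  The preference for non-variable representatives makes the unifier admissible for \<open>unifies_head\<close>,
  which forbids binding a term to a rule variable.
\<close>

lemma mgu_exists:
  assumes "rel P = rel Q" "length (args P) = length (args Q)"
  shows "\<exists>\<theta>. is_mgu \<theta> P Q \<and> (\<forall>X. \<not> is_Var X \<longrightarrow> \<not> is_Var (\<theta> X))"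
proof -
  define Z where "Z = set (zip (args P) (args Q))"
  \<comment> \<open>Terms are opaque, so nothing is decomposed: a unifier must identify
    corresponding arguments, and what follows from this is the equivalence closure \<open>E\<close>.
    One representative per class gives \<open>\<theta>\<close>.\<close>
  define E where "E = (Z \<union> Z\<inverse>)\<^sup>*"
  have symE: "sym E"
    unfolding E_def by (intro sym_rtrancl) (auto simp: sym_def)
  have E: "(X, X) \<in> E" "(X, Y) \<in> E \<Longrightarrow> (Y, X) \<in> E" "(X, Y) \<in> E \<Longrightarrow> (Y, W) \<in> E \<Longrightarrow> (X, W) \<in> E"
    for X Y W
    using symE by (auto simp: E_def sym_def)
  define rep where "rep C = (if \<exists>Y \<in> C. \<not> is_Var Y then SOME Y. Y \<in> C \<and> \<not> is_Var Y else SOME Y. Y \<in> C)"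
    for C :: "('a, 'b, 'c) trm set"
  have rep: "rep C \<in> C \<and> (X \<in> C \<longrightarrow> \<not> is_Var X \<longrightarrow> \<not> is_Var (rep C))" if "C \<noteq> {}" for C X
  proof (cases "\<exists>Y \<in> C. \<not> is_Var Y")
    case True
    then have "\<exists>Y. Y \<in> C \<and> \<not> is_Var Y" by blast
    from someI_ex[OF this] True show ?thesis by (simp add: rep_def)
  next
    case False
    have "(SOME Y. Y \<in> C) \<in> C" using that by (simp add: some_in_eq)
    with False show ?thesis by (auto simp: rep_def)
  qed
  define \<theta> where "\<theta> X = rep (E `` {X})" for X
  have refl: "X \<in> E `` {X}" for X using E(1) by auto
  have \<theta>E: "(X, \<theta> X) \<in> E" for X
    using rep[of "E `` {X}"] refl[of X] unfolding \<theta>_def by blast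
  have \<theta>eq: "\<theta> X = \<theta> Y" if "(X, Y) \<in> E" for X Y
  proof -
    have "E `` {X} = E `` {Y}" using that E(2,3) by blast
    then show ?thesis by (simp add: \<theta>_def)
  qed
  have "unifier \<theta> P Q"
    unfolding unifier_def
  proof (intro conjI assms(1) nth_equalityI)
    fix i assume "i < length (map \<theta> (args P))"
    then have "(args P ! i, args Q ! i) \<in> Z"
      using assms(2) by (auto simp: Z_def set_zip)
    then show "map \<theta> (args P) ! i = map \<theta> (args Q) ! i"
      using \<open>i < _\<close> assms(2) \<theta>eq by (auto simp: E_def)
  qed (use assms in simp)
  moreover have "\<sigma> \<circ> \<theta> = \<sigma>" if "unifier \<sigma> P Q" for \<sigma>
  proof -
    have Z: "\<sigma> X = \<sigma> Y" if "(X, Y) \<in> Z \<union> Z\<inverse>" for X Y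
    proof -
      have "\<sigma> (args P ! i) = \<sigma> (args Q ! i)" if "i < length (args P)" for i
        using \<open>unifier \<sigma> P Q\<close> that assms(2) unfolding unifier_def by (metis nth_map)
      with that show ?thesis by (auto simp: Z_def set_zip)
    qed
    have "\<sigma> X = \<sigma> Y" if "(X, Y) \<in> E" for X Y
      using that unfolding E_def by (induction rule: rtrancl_induct) (simp, metis Z)
    then show ?thesis using \<theta>E by (metis comp_apply ext)
  qed
  ultimately have "is_mgu \<theta> P Q" by (simp add: is_mgu_def)
  moreover have "\<not> is_Var (\<theta> X)" if "\<not> is_Var X" for X
    using rep[of "E `` {X}" X] refl[of X] that unfolding \<theta>_def by blast
  ultimately show ?thesis by blast
qed

text \<open>
  Any set of terms that separates no pair of corresponding arguments is a union of classes of
  identified terms: its indicator function is a unifier.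
\<close>

lemma mgu_invariant:
  assumes "is_mgu \<theta> P Q" "list_all2 (\<lambda>p q. T p \<longleftrightarrow> T q) (args P) (args Q)"
  shows "T (\<theta> X) \<longleftrightarrow> T X"
proof -
  \<comment> \<open>Two distinct terms serve as truth values of the indicator function.\<close>
  define \<sigma> :: "('a, 'b, 'c) trm \<Rightarrow> ('a, 'b, 'c) trm"
    where "\<sigma> X = (if T X then Const undefined else Var undefined)" for X
  have "unifier \<sigma> P Q"
    using assms by (auto simp: unifier_def is_mgu_def \<sigma>_def list_all2_conv_all_nth intro!: nth_equalityI)
  then have "\<sigma> \<circ> \<theta> = \<sigma>" using assms(1) by (simp add: is_mgu_def)
  then have "\<sigma> (\<theta> X) = \<sigma> X" by (metis comp_apply)
  then show ?thesis by (auto simp: \<sigma>_def split: if_splits)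
qed

text \<open>An admissible \<open>\<theta>\<close> fixes every sort name and maps no other term to
  one. Terms with the same image are therefore both equal to a given sort name or both different
  from it.\<close>

lemma unify_imp_same_sorts:
  assumes "unify A H i j H'"
  shows "same_sorts (sorts A) (atoms H ! i) (atoms H ! j)"
proof -
  from assms obtain \<theta> where "is_mgu \<theta> (atoms H ! i) (atoms H ! j)"
    and S: "\<And>X. \<theta> X \<noteq> X \<Longrightarrow> X \<notin> Const ` sorts A \<and> \<theta> X \<notin> Const ` sorts A"
    by (auto simp: unify_def)
  then have rel: "rel (atoms H ! i) = rel (atoms H ! j)"
    and map: "map \<theta> (args (atoms H ! i)) = map \<theta> (args (atoms H ! j))"
    by (simp_all add: is_mgu_def unifier_def)
  have "\<theta> (args (atoms H ! i) ! k) = \<theta> (args (atoms H ! j) ! k)" if "k < length (args (atoms H ! i))" for k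
    using map that by (metis length_map nth_map)
  moreover have "p = Const s \<longleftrightarrow> q = Const s" if "\<theta> p = \<theta> q" "s \<in> sorts A" for p q s
    using that S[of p] S[of q] by (metis imageI)
  ultimately show ?thesis
    unfolding same_sorts_def list_all2_conv_all_nth
    using rel map_eq_imp_length_eq[OF map] by blast
qed

text \<open>A most general unifier identifies only what the arguments force. By
  \<open>mgu_invariant\<close>, applied to the one-element set of each sort name, it neither moves a
  sort name nor moves anything onto one.\<close>

lemma same_sorts_imp_unify:
  assumes "same_sorts (sorts A) (atoms H ! i) (atoms H ! j)"
    and "i < length (atoms H)" "j < length (atoms H)" "i \<noteq> j"
  obtains H' where "unify A H i j H'" "atoms H' = atoms H"
proof -
  obtain \<theta> where \<theta>: "is_mgu \<theta> (atoms H ! i) (atoms H ! j)"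
    using assms(1) mgu_exists[of "atoms H ! i" "atoms H ! j"] list_all2_lengthD
    unfolding same_sorts_def by blast
  have "\<theta> X = Const s \<longleftrightarrow> X = Const s" if "s \<in> sorts A" for X s
    using mgu_invariant[OF \<theta>, of "\<lambda>X. X = Const s"] assms(1) that
    by (auto simp: same_sorts_def list_all2_conv_all_nth)
  then have "X \<notin> Const ` sorts A \<and> \<theta> X \<notin> Const ` sorts A" if "\<theta> X \<noteq> X" for X
    using that by auto
  with assms \<theta> show thesis
    by (intro that[of "\<lparr>atoms = atoms H, eqs = eqs H \<union> {(X, \<theta> X) | X. \<theta> X \<noteq> X}\<rparr>"])
      (auto simp: unify_def)
qed

section \<open>Back-chaining of compatible atoms with the same axiom\<close>

abbreviation ground :: "('p, 'v, 'c) atm \<Rightarrow> bool" where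
  "ground P \<equiv> \<forall>t \<in> set (args P). \<not> is_Var t"

lemma unifies_head_sort:
  assumes "unifies_head S \<theta> P ax" "s \<in> S" "\<not> is_Var X"
  shows "\<theta> X = Const s \<longleftrightarrow> X = Const s"
  using assms unfolding unifies_head_def by (metis imageI)

lemma unifies_head_ground:
  assumes "unifies_head S \<theta> P ax" "\<not> is_Var X"
  shows "\<not> is_Var (\<theta> X)"
  using assms unfolding unifies_head_def by metis

text \<open>Prepares \<open>mgu_invariant\<close> for the unification of \<open>Q\<close> with the
  head, with \<open>T\<close> the set of terms that \<open>\<theta>\<close> sends to
  \<open>Const s\<close>. Besides \<open>Const s\<close> this set contains the rule variables bound
  to \<open>s\<close>, so it separates no argument of \<open>Q\<close> from its head
  argument.\<close>

lemma unifies_head_invariant: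
  assumes "unifies_head S \<theta> P ax" "same_sorts S P Q" "ground P" "ground Q" "s \<in> S"
  shows "list_all2 (\<lambda>q h. \<theta> q = Const s \<longleftrightarrow> \<theta> h = Const s) (args Q) (args (head ax))"
proof -
  have "map \<theta> (args P) = map \<theta> (args (head ax))"
    using assms(1) by (simp add: unifies_head_def is_mgu_def unifier_def)
  then have len: "length (args P) = length (args (head ax))"
    and \<theta>: "\<And>k. k < length (args P) \<Longrightarrow> \<theta> (args P ! k) = \<theta> (args (head ax) ! k)"
    by (metis length_map, metis length_map nth_map)
  have "\<theta> (args Q ! k) = Const s \<longleftrightarrow> \<theta> (args P ! k) = Const s" if "k < length (args P)" for k
  proof -
    have "args P ! k \<in> set (args P)" "args Q ! k \<in> set (args Q)"
      using that assms(2) by (auto simp: same_sorts_def list_all2_conv_all_nth)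
    then show ?thesis
      using unifies_head_sort[OF assms(1,5)] assms(2-5) that
      by (auto simp: same_sorts_def list_all2_conv_all_nth)
  qed
  with len \<theta> assms(2) show ?thesis
    by (auto simp: same_sorts_def list_all2_conv_all_nth)
qed

text \<open>A most general unifier of \<open>Q\<close> and the head respects the set of terms that
  \<open>\<theta>\<close> sends to a sort name. The sort name is the only non-variable term in that
  set, so no forbidden binding arises; rule variables may still be bound to it.\<close>

lemma unifies_head_transfer:
  assumes "unifies_head S \<theta> P ax" "same_sorts S P Q" "ground P" "ground Q"
  obtains \<theta>' where "unifies_head S \<theta>' Q ax"
proof -
  have "map \<theta> (args P) = map \<theta> (args (head ax))" "rel P = rel (head ax)"
    using assms(1) by (simp_all add: unifies_head_def is_mgu_def unifier_def)
  then have "rel Q = rel (head ax)" "length (args Q) = length (args (head ax))"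
    using assms(2) by (auto simp: same_sorts_def dest!: list_all2_lengthD dest: map_eq_imp_length_eq)
  then obtain \<theta>' where \<theta>': "is_mgu \<theta>' Q (head ax)" "\<And>X. \<not> is_Var X \<Longrightarrow> \<not> is_Var (\<theta>' X)"
    using mgu_exists[of Q "head ax"] by blast
  have "\<theta>' X = Const s \<longleftrightarrow> X = Const s" if "\<not> is_Var X" "s \<in> S" for X s
    using mgu_invariant[OF \<theta>'(1) unifies_head_invariant[OF assms that(2)], of X]
      unifies_head_sort[OF assms(1) that(2)] that(1) \<theta>'(2) by simp
  then have "unifies_head S \<theta>' Q ax"
    unfolding unifies_head_def using \<theta>' by (metis imageE)
  then show thesis by (rule that)
qed

lemma unifies_head_var_ground:
  assumes "unifies_head S \<theta> P ax" "ground P" "y \<in> atm_vars (head ax)"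
  shows "\<not> is_Var (\<theta> (Var y))"
proof -
  have *: "map \<theta> (args P) = map \<theta> (args (head ax))"
    using assms(1) by (simp add: unifies_head_def is_mgu_def unifier_def)
  have "\<theta> (Var y) \<in> \<theta> ` set (args (head ax))" using assms(3) by (auto simp: atm_vars_def)
  also have "\<dots> = \<theta> ` set (args P)" using * by (metis set_map)
  finally show ?thesis using assms(2) unifies_head_ground[OF assms(1)] by (metis imageE)
qed

lemma body_trm_ground:
  assumes "unifies_head S \<theta> P ax" "ground P"
  shows "\<not> is_Var (body_trm ax \<theta> t)"
  using unifies_head_var_ground[OF assms] unifies_head_ground[OF assms(1)]
  by (auto simp: body_trm_def split: trm.splits)

lemma body_inst_ground:
  assumes "unifies_head S \<theta> P ax" "ground P" "R \<in> set (body_inst ax \<theta>)"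
  shows "ground R"
proof -
  obtain P' where "args R = map (body_trm ax \<theta>) (args P')"
    using assms(3) by (auto simp: body_inst_def)
  then show ?thesis using body_trm_ground[OF assms(1,2)] by (metis ex_map_conv)
qed

text \<open>A Skolem term is not a constant, so the main case is a head variable that
  \<open>\<theta>\<close> binds to \<open>s\<close>. Its image under \<open>\<theta>'\<close> stays
  in the set of terms sent to \<open>s\<close> by \<open>\<theta>\<close> and is not a variable,
  hence it is \<open>s\<close>. The converse follows by exchanging \<open>P\<close> and
  \<open>Q\<close>.\<close>

lemma body_trm_sort:
  assumes "unifies_head S \<theta> P ax" "unifies_head S \<theta>' Q ax" "same_sorts S P Q" "ground P" "ground Q"
    and "s \<in> S" "body_trm ax \<theta> t = Const s"
  shows "body_trm ax \<theta>' t = Const s"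
proof (cases t)
  case (Var y)
  then have y: "y \<in> atm_vars (head ax)" "\<theta> (Var y) = Const s"
    using assms(7) by (auto simp: body_trm_def split: if_splits)
  have mgu: "is_mgu \<theta>' Q (head ax)" using assms(2) by (simp add: unifies_head_def)
  have "\<theta> (\<theta>' (Var y)) = Const s"
    using mgu_invariant[OF mgu unifies_head_invariant[OF assms(1,3-6)]] y(2) by blast
  then have "\<theta>' (Var y) = Const s"
    using unifies_head_sort[OF assms(1,6)] unifies_head_var_ground[OF assms(2,5) y(1)] by blast
  with y(1) Var show ?thesis by (simp add: body_trm_def)
qed (use assms(7) unifies_head_sort[OF assms(1,6)] unifies_head_sort[OF assms(2,6)]
      in \<open>auto simp: body_trm_def\<close>)

text \<open>This allows each body atom introduced for \<open>Q\<close> to be factored with its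
  counterpart for \<open>P\<close>. Their Skolem terms may differ, but these can be bound like any
  term that is not a sort name.\<close>

lemma body_inst_same_sorts:
  assumes "unifies_head S \<theta> P ax" "unifies_head S \<theta>' Q ax" "same_sorts S P Q" "ground P" "ground Q"
    and "k < length (body ax)"
  shows "same_sorts S (body_inst ax \<theta> ! k) (body_inst ax \<theta>' ! k)"
proof -
  have "body_trm ax \<theta> t = Const s \<longleftrightarrow> body_trm ax \<theta>' t = Const s" if "s \<in> S" for s t
    using body_trm_sort[OF assms(1-5) that]
      body_trm_sort[OF assms(2,1) same_sorts_sym[OF assms(3)] assms(5,4) that] by blast
  then show ?thesis
    using assms(6) by (simp add: same_sorts_def body_inst_def list_all2_conv_all_nth)
qed

section \<open>Operation sequences: invariants and rearrangement\<close>

lemma generated_ground: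
  assumes "generated A H I F" "abduction_instance A" "P \<in> set (atoms H)"
  shows "ground P"
  using assms
proof (induction arbitrary: P rule: generated.induct)
  case initial
  then show ?case by (fastforce simp: initial_hyp_def abduction_instance_def)
next
  case (back_chaining H I F i ax H')
  then obtain \<theta> where "unifies_head (sorts A) \<theta> (atoms H ! i) ax" "i < length (atoms H)"
    "H' = \<lparr>atoms = atoms H @ body_inst ax \<theta>, eqs = eqs H\<rparr>"
    by (auto simp: back_chain_def)
  with back_chaining body_inst_ground[of "sorts A" \<theta> "atoms H ! i" ax P] show ?case
    by (metis Un_iff nth_mem set_append hypothesis.select_convs(1))
next
  case (unification H I F i j H')
  then have "atoms H' = atoms H" by (auto simp: unify_def)
  with unification show ?case by metis
qed

text \<open>Formulated for the list of atoms alone, so that it survives appending atoms and any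
  change of the equalities.\<close>

definition inference_ok ::
  "('p, 'v, 'c) abduction \<Rightarrow> ('p, 'v, 'c) atm list \<Rightarrow> nat \<times> ('p, 'v, 'c) axm \<times> nat list \<Rightarrow> bool" where
  "inference_ok A as = (\<lambda>(P, ax, bs).
     P < length as \<and> ax \<in> axioms A \<and> length bs = length (body ax) \<and>
     set bs \<subseteq> {length (obs A)..<length as} \<and>
     (\<exists>\<theta>. unifies_head (sorts A) \<theta> (as ! P) ax \<and> map ((!) as) bs = body_inst ax \<theta>))"

lemma inference_ok_append:
  assumes "inference_ok A as x" shows "inference_ok A (as @ as') x"
proof -
  obtain P ax bs where x: "x = (P, ax, bs)" by (cases x)
  then have "map ((!) (as @ as')) bs = map ((!) as) bs"
    using assms by (fastforce simp: inference_ok_def nth_append)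
  moreover have "(as @ as') ! P = as ! P" if "P < length as" using that by (simp add: nth_append)
  ultimately show ?thesis using assms x by (auto simp: inference_ok_def simp del: map_eq_conv)
qed

lemma generated_inferences:
  assumes "generated A H I F"
  shows "length (obs A) \<le> length (atoms H) \<and> (\<forall>x \<in> I. inference_ok A (atoms H) x)"
  using assms
proof (induction rule: generated.induct)
  case (back_chaining H I F i ax H')
  then obtain \<theta> where \<theta>: "unifies_head (sorts A) \<theta> (atoms H ! i) ax" "i < length (atoms H)" "ax \<in> axioms A"
    "H' = \<lparr>atoms = atoms H @ body_inst ax \<theta>, eqs = eqs H\<rparr>"
    by (auto simp: back_chain_def)
  moreover have "length (body_inst ax \<theta>) = length (body ax)" by (simp add: body_inst_def)
  moreover have "map ((!) (atoms H @ body_inst ax \<theta>)) [length (atoms H)..<length (atoms H) + length (body_inst ax \<theta>)]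
      = body_inst ax \<theta>"
    by (intro nth_equalityI) auto
  ultimately have "inference_ok A (atoms H') (i, ax, [length (atoms H)..<length (atoms H')])"
    using back_chaining.IH by (auto simp: inference_ok_def nth_append)
  with back_chaining.IH \<theta>(4) show ?case by (auto intro: inference_ok_append)
qed (auto simp: initial_hyp_def unify_def)

lemma generated_factorings:
  assumes "generated A H I F" "(i, j) \<in> F"
  shows "i < length (atoms H) \<and> j < length (atoms H) \<and> i \<noteq> j \<and>
    same_sorts (sorts A) (atoms H ! i) (atoms H ! j)"
  using assms
proof (induction rule: generated.induct)
  case (unification H I F i' j' H')
  then show ?case using unify_imp_same_sorts[of A H i' j' H'] by (auto simp: unify_def)
qed (auto simp: back_chain_def nth_append)

text \<open>Supplies an atom outside the observation with a source of cost other than a factoring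
  edge.\<close>

lemma generated_origin:
  assumes "generated A H I F" "length (obs A) \<le> n" "n < length (atoms H)"
  shows "\<exists>P ax bs. (P, ax, bs) \<in> I \<and> n \<in> set bs"
  using assms
proof (induction rule: generated.induct)
  case (back_chaining H I F i ax H')
  show ?case
  proof (cases "n < length (atoms H)")
    case True
    with back_chaining.IH back_chaining.prems show ?thesis by blast
  next
    case False
    with back_chaining.prems have "n \<in> set [length (atoms H)..<length (atoms H')]" by simp
    then show ?thesis by blast
  qed
qed (auto simp: initial_hyp_def unify_def)

text \<open>Back-chaining looks only at the atoms, and unification changes only the equalities. So
  the back-chainings can be repeated without the unifications, with all positions unchanged.\<close>

lemma generated_drop_factorings:
  assumes "generated A H I F"
  shows "\<exists>H'. atoms H' = atoms H \<and> generated A H' I {}"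
  using assms
proof (induction rule: generated.induct)
  case (back_chaining H I F i ax H')
  then obtain H0 where H0: "atoms H0 = atoms H" "generated A H0 I {}" by blast
  with back_chaining(2) have "back_chain A H0 i ax \<lparr>atoms = atoms H', eqs = eqs H0\<rparr>"
    by (auto simp: back_chain_def)
  from generated.back_chaining[OF H0(2) this] show ?case
    using H0(1) by (intro exI[of _ "\<lparr>atoms = atoms H', eqs = eqs H0\<rparr>"]) simp
qed (auto simp: unify_def intro: generated.initial)

text \<open>Accumulated equalities restrict no later operation, so unifications can be performed one
  after the other at the end. Together with \<open>generated_drop_factorings\<close> this makes the
  factoring edges replaceable by any finite set of compatible pairs.\<close>

lemma generated_add_factorings:
  assumes "generated A H I {}" "finite F"
    and "\<And>i j. (i, j) \<in> F \<Longrightarrow> i < length (atoms H) \<and> j < length (atoms H) \<and> i \<noteq> j \<and>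
           same_sorts (sorts A) (atoms H ! i) (atoms H ! j)"
  shows "\<exists>H'. atoms H' = atoms H \<and> generated A H' I F"
  using assms(2,3)
proof (induction rule: finite_induct)
  case empty
  with assms(1) show ?case by blast
next
  case (insert x F)
  obtain i j where x: "x = (i, j)" by (cases x)
  from insert obtain H0 where H0: "atoms H0 = atoms H" "generated A H0 I F" by blast
  have "same_sorts (sorts A) (atoms H0 ! i) (atoms H0 ! j)"
    "i < length (atoms H0)" "j < length (atoms H0)" "i \<noteq> j"
    using insert.prems[of i j] H0 x by simp_all
  then obtain H' where "unify A H0 i j H'" "atoms H' = atoms H0"
    by (rule same_sorts_imp_unify)
  with H0 x show ?case by (metis generated.unification)
qed

section \<open>Elementary properties of proof graphs\<close>

lemma proof_graph_finite:
  assumes "proof_graph A H G"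
  shows "finite (inferences G)" "finite (factorings G)" "finite (edges G)" "finite (abduced G)"
proof -
  show fin: "finite (inferences G)" "finite (factorings G)"
    using assms generated_finite by (auto simp: proof_graph_def)
  have "edges G = (\<Union>(P, ax, bs) \<in> inferences G. set bs \<times> {P}) \<union> factorings G"
    by (fastforce simp: edges_def)
  with fin show "finite (edges G)" by auto
  show "finite (abduced G)"
    using assms by (simp add: abduced_def proof_graph_def)
qed

lemma proof_graph_inference:
  assumes "proof_graph A H G" "(P, ax, bs) \<in> inferences G"
  shows "inference_ok A (atoms H) (P, ax, bs)"
  using assms generated_inferences unfolding proof_graph_def by blast

lemma proof_graph_edges:
  assumes "proof_graph A H G" "(x, y) \<in> edges G"
  shows "x < length (atoms H)" "y < length (atoms H)"
proof -
  consider ax bs where "(y, ax, bs) \<in> inferences G" "x \<in> set bs" | "(x, y) \<in> factorings G"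
    using assms(2) by (auto simp: edges_def)
  then have "x < length (atoms H) \<and> y < length (atoms H)"
  proof cases
    case 1
    with proof_graph_inference[OF assms(1) 1(1)] show ?thesis by (auto simp: inference_ok_def)
  next
    case 2
    with assms(1) generated_factorings show ?thesis by (fastforce simp: proof_graph_def)
  qed
  then show "x < length (atoms H)" "y < length (atoms H)" by auto
qed

lemma proof_graph_justification:
  assumes "proof_graph A H G"
  shows "(Q, x) \<in> inferences G \<Longrightarrow> (Q, y) \<in> inferences G \<Longrightarrow> x = y"
    and "(P, Q) \<in> factorings G \<Longrightarrow> (P', Q) \<in> factorings G \<Longrightarrow> P = P'"
    and "(P, Q) \<in> factorings G \<Longrightarrow> (Q, x) \<notin> inferences G"
  using assms unfolding proof_graph_def singly_justified_def by blast+

section \<open>Weighted abduction under shortcuts\<close>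

text \<open>With weight 1 for factoring edges, every edge contributes the minimal cost of its target
  times its weight, and both kinds can be treated alike.\<close>

definition weighted_edges ::
  "(('p, 'v, 'c) axm \<Rightarrow> nat \<Rightarrow> real) \<Rightarrow> ('p, 'v, 'c) pgraph \<Rightarrow> (nat \<times> real \<times> nat) set" where
  "weighted_edges w G =
     {(bs ! k, w ax k, P) | P ax bs k. (P, ax, bs) \<in> inferences G \<and> k < length bs} \<union>
     {(x, 1, P) | x P. (x, P) \<in> factorings G}"

lemma edges_eq_weighted: "(x, y) \<in> edges G \<longleftrightarrow> (\<exists>u. (x, u, y) \<in> weighted_edges w G)"
  by (auto simp: edges_def weighted_edges_def in_set_conv_nth)

lemma cost_eq:
  assumes "proof_graph A H G"
  shows "cost A w ic G n = (if n < length (obs A) then {ic (obs A ! n)} else {}) \<union>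
    {Min (cost A w ic G y) * u | u y. (n, u, y) \<in> weighted_edges w G}"
proof -
  let ?f = "\<lambda>y. Min (cost A w ic G y)"
  have "{?f y * u | u y. (n, u, y) \<in> weighted_edges w G} =
    {?f P * w ax k | P ax bs k. (P, ax, bs) \<in> inferences G \<and> k < length bs \<and> bs ! k = n} \<union>
    {?f P | P. (n, P) \<in> factorings G}" (is "?L = ?I \<union> ?F")
  proof (intro subset_antisym subsetI)
    fix r assume "r \<in> ?L"
    then show "r \<in> ?I \<union> ?F" unfolding weighted_edges_def by force
  next
    have W: "\<And>P ax bs k. (P, ax, bs) \<in> inferences G \<Longrightarrow> k < length bs \<Longrightarrow>
        (bs ! k, w ax k, P) \<in> weighted_edges w G"
      "\<And>P. (n, P) \<in> factorings G \<Longrightarrow> (n, 1, P) \<in> weighted_edges w G"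
      unfolding weighted_edges_def by blast+
    fix r assume "r \<in> ?I \<union> ?F"
    then show "r \<in> ?L"
    proof
      assume "r \<in> ?F"
      then obtain P where "r = ?f P * 1" "(n, P) \<in> factorings G" by auto
      with W(2) show ?thesis by blast
    qed (use W(1) in blast)
  qed
  with cost_rec[OF assms, of w ic n] show ?thesis by (simp add: cost_step_def Un_assoc)
qed

text \<open>Empty sets are covered too: the conditions make both sets empty or neither.\<close>

lemma Min_eq_cofinal:
  fixes A B :: "real set"
  assumes "finite A" "finite B"
    and "\<And>a. a \<in> A \<Longrightarrow> \<exists>b \<in> B. b \<le> a" "\<And>b. b \<in> B \<Longrightarrow> \<exists>a \<in> A. a \<le> b"
  shows "Min A = Min B"
proof (cases "A = {}")
  case True
  with assms(4) show ?thesis by (metis all_not_in_conv)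
next
  case False
  with assms(3) have "B \<noteq> {}" by blast
  with False assms show ?thesis
    by (intro antisym) (meson Min_in Min_le order_trans)+
qed

lemma finite_cost_set:
  fixes f :: "nat \<Rightarrow> real" and W :: "(nat \<times> real \<times> nat) set"
  assumes "finite W"
  shows "finite {f y * u | u y. (x, u, y) \<in> W}"
proof (rule finite_subset)
  show "{f y * u | u y. (x, u, y) \<in> W} \<subseteq> (\<lambda>(z, u, y). f y * u) ` W" by force
qed (use assms in simp)

text \<open>
  The cost of \<open>P\<close> itself may grow when the edge from \<open>P\<close> to \<open>Q\<close> is removed; the second conjunct says
  that exactly the contribution of \<open>Q\<close> is lost, which the shortcuts then supply.
\<close>

lemma shortcut_Min:
  fixes c c' base :: "nat \<Rightarrow> real set" and W :: "(nat \<times> real \<times> nat) set" and P Q :: nat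
  defines "W' \<equiv> W - {(P, 1, Q)} \<union> {(x, u, Q) | x u. (x, u, P) \<in> W}"
  assumes c: "\<And>x. x \<in> V \<Longrightarrow> c x = base x \<union> {Min (c y) * u | u y. (x, u, y) \<in> W}"
    and c': "\<And>x. x \<in> V \<Longrightarrow> c' x = base x \<union> {Min (c' y) * u | u y. (x, u, y) \<in> W'}"
    and V: "\<And>x u y. (x, u, y) \<in> W \<Longrightarrow> x \<in> V \<and> y \<in> V"
    and fin: "finite W" "\<And>x. finite (base x)"
    and wf: "wf {(y, x). \<exists>u. (x, u, y) \<in> W}"
    and PQ: "(P, 1, Q) \<in> W"
    and nonneg: "\<And>x u. (x, u, P) \<in> W \<Longrightarrow> 0 \<le> u"
    and ne: "base P \<noteq> {} \<or> (\<exists>u y. (P, u, y) \<in> W \<and> y \<noteq> Q)"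
    and "x \<in> V"
  shows "(x \<noteq> P \<longrightarrow> Min (c' x) = Min (c x)) \<and> (x = P \<longrightarrow> Min (c P) = min (Min (c' P)) (Min (c' Q)))"
  using wf \<open>x \<in> V\<close>
\<comment> \<open>The induction follows the edges backwards, since the cost of an atom depends on
  the targets of its edges.\<close>
proof (induction x)
  case (less x)
  have irrefl: "(y, u, y) \<notin> W" for y u using wf wf_not_refl by fastforce
  have finW': "finite W'"
  proof -
    have "{(x, u, Q) | x u. (x, u, P) \<in> W} \<subseteq> (\<lambda>(x, u, y). (x, u, Q)) ` W" by force
    then show ?thesis using fin(1) unfolding W'_def by (meson finite_Diff finite_UnI finite_imageI finite_subset)
  qed
  have IH: "Min (c' y) = Min (c y)" if "(x, u, y) \<in> W" "y \<noteq> P" for u y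
    using less.IH[of y] V that by blast
  have fc: "finite (c x)" "finite (c' x)"
    using c[OF less.prems] c'[OF less.prems] finite_cost_set[OF fin(1)] finite_cost_set[OF finW'] fin(2) by simp_all
  show ?case
  proof (cases "x = P")
    case True
    have succ: "(P, u, y) \<in> W' \<longleftrightarrow> (P, u, y) \<in> W \<and> (u, y) \<noteq> (1, Q)" for u y
      using irrefl by (auto simp: W'_def)
    have "{Min (c' y) * u | u y. (P, u, y) \<in> W'} =
          {Min (c y) * u | u y. (P, u, y) \<in> W \<and> (u, y) \<noteq> (1, Q)}"
      using IH irrefl unfolding succ True by (intro Collect_cong) metis
    then have 1: "c' P = base P \<union> {Min (c y) * u | u y. (P, u, y) \<in> W \<and> (u, y) \<noteq> (1, Q)}"
      using c' less.prems True by simp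
    have "c P = insert (Min (c Q) * 1) (base P \<union> {Min (c y) * u | u y. (P, u, y) \<in> W \<and> (u, y) \<noteq> (1, Q)})"
      using c[of P] less.prems PQ unfolding True by (auto, metis mult.right_neutral)
    with 1 have "c P = insert (Min (c Q)) (c' P)" by simp
    \<comment> \<open>Without a remaining cost, \<open>Min\<close> of the rest would be an
      unspecified value and would not split off from the minimum.\<close>
    moreover have "c' P \<noteq> {}" using 1 ne by blast
    moreover have "Min (c' Q) = Min (c Q)" using IH PQ irrefl True by metis
    ultimately show ?thesis using True fc by (simp add: min.commute)
  next
    case False
    have P: "Min (c P) = min (Min (c' P)) (Min (c' Q))" if "(x, u, P) \<in> W" for u
      using less.IH[of P] V that by blast
    have "Min (c x) = Min (c' x)"
    proof (rule Min_eq_cofinal[OF fc])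
      fix a assume "a \<in> c x"
      then consider "a \<in> base x" | u y where "(x, u, y) \<in> W" "y \<noteq> P" "a = Min (c y) * u"
        | u where "(x, u, P) \<in> W" "a = Min (c P) * u"
        using c[OF less.prems] by blast
      then show "\<exists>b \<in> c' x. b \<le> a"
      proof cases
        case 1
        with c'[OF less.prems] show ?thesis by blast
      next
        case 2
        then have "(x, u, y) \<in> W'" "a = Min (c' y) * u" using IH False by (auto simp: W'_def)
        with c'[OF less.prems] show ?thesis by blast
      next
        case 3
        then have "(x, u, P) \<in> W'" "(x, u, Q) \<in> W'" using False by (auto simp: W'_def)
        then have "Min (c' P) * u \<in> c' x" "Min (c' Q) * u \<in> c' x" using c'[OF less.prems] by blast+
        moreover have "a = Min (c' P) * u \<or> a = Min (c' Q) * u" using 3 P by (simp add: min_def)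
        ultimately show ?thesis by blast
      qed
    next
      fix b assume "b \<in> c' x"
      then consider "b \<in> base x" | u y where "(x, u, y) \<in> W" "y \<noteq> P" "b = Min (c' y) * u"
        | u y where "(x, u, P) \<in> W" "y = P \<or> y = Q" "b = Min (c' y) * u"
        using c'[OF less.prems] unfolding W'_def by blast
      then show "\<exists>a \<in> c x. a \<le> b"
      proof cases
        case 1
        with c[OF less.prems] show ?thesis by blast
      next
        case 2
        then have "b = Min (c y) * u" using IH by simp
        with 2 c[OF less.prems] show ?thesis by blast
      next
        case 3
        \<comment> \<open>Nonnegative weights enter here: multiplication by \<open>u\<close> must
          preserve this inequality.\<close>
        have "Min (c P) \<le> Min (c' y)" using P[OF 3(1)] 3(2) by auto
        then have "Min (c P) * u \<le> b" using nonneg 3 by (simp add: mult_right_mono)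
        with 3 c[OF less.prems] show ?thesis by blast
      qed
    qed
    with False show ?thesis by simp
  qed
qed

text \<open>The last assumption compares sets of contributions instead of edges, and only at atoms
  of \<open>H\<close>, so that \<open>G'\<close> may route a shortcut through new atoms. The cost of
  \<open>P\<close> may change, but \<open>P\<close> is not abduced and does not enter the
  sum.\<close>

lemma WA_shortcut:
  fixes A :: "('p, 'v, 'c) abduction" and G :: "('p, 'v, 'c) pgraph" and w ic and P Q :: nat
  defines "W \<equiv> weighted_edges w G"
  assumes pg: "proof_graph A H G" "proof_graph A H' G'"
    and nonneg: "\<forall>ax \<in> axioms A. \<forall>k < length (body ax). 0 \<le> w ax k"
    and PQ: "(P, Q) \<in> factorings G" "P \<notin> abduced G"
    and ab: "abduced G' = abduced G"
    and c': "\<And>x. x < length (atoms H) \<Longrightarrow>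
      {Min (cost A w ic G' y) * u | u y. (x, u, y) \<in> weighted_edges w G'} =
      {Min (cost A w ic G' y) * u | u y. (x, u, y) \<in> W - {(P, 1, Q)} \<union> {(x, u, Q) | x u. (x, u, P) \<in> W}}"
  shows "WA_obj A w ic G' = WA_obj A w ic G"
proof -
  define base where "base n = (if n < length (obs A) then {ic (obs A ! n)} else {})" for n
  have eq: "cost A w ic G x = base x \<union> {Min (cost A w ic G y) * u | u y. (x, u, y) \<in> W}" for x
    unfolding base_def W_def by (rule cost_eq[OF pg(1)])
  have eq': "cost A w ic G' x = base x \<union> {Min (cost A w ic G' y) * u | u y.
      (x, u, y) \<in> W - {(P, 1, Q)} \<union> {(x, u, Q) | x u. (x, u, P) \<in> W}}"
    if "x \<in> {..<length (atoms H)}" for x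
    using cost_eq[OF pg(2), of w ic x] c'[of x] that unfolding base_def by simp
  have V: "x \<in> {..<length (atoms H)} \<and> y \<in> {..<length (atoms H)}" if "(x, u, y) \<in> W" for x u y
    using proof_graph_edges[OF pg(1)] edges_eq_weighted that unfolding W_def by blast
  have "W \<subseteq> (\<Union>(P, ax, bs) \<in> inferences G. (\<lambda>k. (bs ! k, w ax k, P)) ` {..<length bs}) \<union>
      (\<lambda>(x, y). (x, 1, y)) ` factorings G"
    unfolding W_def weighted_edges_def by fastforce
  moreover have "finite ((\<Union>(P, ax, bs) \<in> inferences G. (\<lambda>k. (bs ! k, w ax k, P)) ` {..<length bs}) \<union>
      (\<lambda>(x, y). (x, 1 :: real, y)) ` factorings G)"
    using proof_graph_finite[OF pg(1)] by auto
  ultimately have finW: "finite W" by (rule finite_subset)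
  have "{(y, x). \<exists>u. (x, u, y) \<in> W} = (edges G)\<inverse>"
    using edges_eq_weighted unfolding W_def by fastforce
  then have wf: "wf {(y, x). \<exists>u. (x, u, y) \<in> W}"
    using pg(1) finite_acyclic_wf_converse[OF proof_graph_finite(3)[OF pg(1)]]
    by (simp add: proof_graph_def)
  have PQW: "(P, 1, Q) \<in> W" using PQ(1) by (auto simp: W_def weighted_edges_def)
  have pos: "0 \<le> u" if "(x, u, P) \<in> W" for x u
    using that nonneg proof_graph_inference[OF pg(1)]
    by (fastforce simp: W_def weighted_edges_def inference_ok_def)
  \<comment> \<open>If \<open>P\<close> is not in the observation, it is a body atom of some
    back-chained \<open>y\<close>. This \<open>y\<close> is not \<open>Q\<close>, because
    \<open>Q\<close> is factored and so has no inference.\<close>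
  have ne: "base P \<noteq> {} \<or> (\<exists>u y. (P, u, y) \<in> W \<and> y \<noteq> Q)"
  proof (cases "P < length (obs A)")
    case False
    moreover have "P < length (atoms H)" using V PQW by blast
    ultimately obtain y ax bs where y: "(y, ax, bs) \<in> inferences G" "P \<in> set bs"
      using generated_origin[of A H "inferences G" "factorings G" P] pg(1)
      by (auto simp: proof_graph_def)
    then have "y \<noteq> Q" using PQ(1) proof_graph_justification(3)[OF pg(1)] by blast
    moreover have "\<exists>u. (P, u, y) \<in> W"
      using y edges_eq_weighted unfolding W_def edges_def by blast
    ultimately show ?thesis by blast
  qed (simp add: base_def)
  have "Min (cost A w ic G' a) = Min (cost A w ic G a)" if "a \<in> abduced G" for a
  proof -
    have a: "a \<in> {..<length (atoms H)}" "a \<noteq> P"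
      using that PQ(2) pg(1) by (auto simp: abduced_def proof_graph_def)
    have fin: "finite (base x)" for x by (simp add: base_def)
    note * = shortcut_Min[where V = "{..<length (atoms H)}" and c = "cost A w ic G"
        and c' = "cost A w ic G'" and base = base and x = a and W = W and P = P and Q = Q]
    show ?thesis
      by (rule *[THEN conjunct1, THEN mp], rule eq, erule eq', erule V, rule finW, rule fin,
          rule wf, rule PQW, erule pos, rule ne, rule a, rule a)
  qed
  with ab show ?thesis by (simp add: WA_obj_def)
qed

section \<open>Reachability and coherence under shortcuts\<close>

text \<open>A path that uses the edge from \<open>P\<close> to \<open>Q\<close> skips
  \<open>P\<close> by a shortcut from the preceding node. A path that starts in \<open>P\<close> has
  no preceding node, so it is replaced by paths from all predecessors of \<open>P\<close>.\<close>

lemma shortcut_rtrancl: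
  fixes E :: "('a \<times> 'a) set" and P Q :: 'a
  assumes "acyclic E" "(x, a) \<in> E\<^sup>*"
  defines "E' \<equiv> E - {(P, Q)} \<union> {(x, Q) | x. (x, P) \<in> E}"
  shows "(x \<noteq> P \<longrightarrow> (x, a) \<in> E'\<^sup>*) \<and> (x = P \<longrightarrow> (\<forall>z. (z, P) \<in> E \<longrightarrow> (z, a) \<in> E'\<^sup>*))"
  using assms(2)
proof (induction rule: converse_rtrancl_induct)
  case base
  have irrefl: "(y, y) \<notin> E" for y using assms(1) by (auto simp: acyclic_def)
  then have "(z, P) \<in> E'" if "(z, P) \<in> E" for z using that by (auto simp: E'_def)
  then show ?case by blast
next
  case (step x y)
  have irrefl: "(y, y) \<notin> E" for y using assms(1) by (auto simp: acyclic_def)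
  have in_E': "(z, P) \<in> E'" if "(z, P) \<in> E" for z using that irrefl by (auto simp: E'_def)
  show ?case
  proof (cases "x = P")
    case False
    then have "(x, y) \<in> E'" using step.hyps by (auto simp: E'_def)
    then have "(x, a) \<in> E'\<^sup>*" if "y \<noteq> P" using step.IH that by (meson converse_rtrancl_into_rtrancl)
    moreover have "(x, a) \<in> E'\<^sup>*" if "y = P" using step.IH step.hyps(1) that by blast
    ultimately show ?thesis using False by blast
  next
    case True
    have yP: "y \<noteq> P" using True step.hyps irrefl by blast
    have "(z, a) \<in> E'\<^sup>*" if "(z, P) \<in> E" for z
    proof (cases "y = Q")
      case True
      then have "(z, y) \<in> E'" using that by (auto simp: E'_def)
      then show ?thesis using step.IH yP by (meson converse_rtrancl_into_rtrancl)
    next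
      case False
      then have "(P, y) \<in> E'" using step.hyps True by (auto simp: E'_def)
      then show ?thesis using step.IH yP in_E'[OF that] by (meson converse_rtrancl_into_rtrancl)
    qed
    with True show ?thesis by blast
  qed
qed

text \<open>The map \<open>\<pi>\<close> contracts new atoms and carries common ancestors from
  \<open>G'\<close> to \<open>G\<close>. Conversely a common ancestor in \<open>G\<close> is kept,
  except that \<open>P\<close> is replaced by its predecessor \<open>b\<close>, which still reaches
  all that \<open>P\<close> reached.\<close>

lemma COH_shortcut:
  assumes "acyclic (edges G)" "(b, P) \<in> edges G" "b \<in> nodes G"
    and hom: "\<And>x y. (x, y) \<in> edges G' \<Longrightarrow> (\<pi> x, \<pi> y) \<in> (edges G)\<^sup>*"
    and \<pi>: "\<And>x. x \<in> nodes G' \<Longrightarrow> \<pi> x \<in> nodes G" "\<And>a. a < length (obs A) \<Longrightarrow> \<pi> a = a"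
    and sub: "edges G - {(P, Q)} \<union> {(x, Q) | x. (x, P) \<in> edges G} \<subseteq> (edges G')\<^sup>*"
    and nodes: "nodes G \<subseteq> nodes G'"
  shows "COH_obj A lt G' = COH_obj A lt G"
proof -
  have up: "(\<pi> x, \<pi> y) \<in> (edges G)\<^sup>*" if "(x, y) \<in> (edges G')\<^sup>*" for x y
    using that by (induction rule: rtrancl_induct) (auto dest: hom intro: rtrancl_trans)
  have down: "(if x = P then b else x, a) \<in> (edges G')\<^sup>*" if "(x, a) \<in> (edges G)\<^sup>*" for x a
    using shortcut_rtrancl[OF assms(1) that, of P Q] rtrancl_mono[OF sub] assms(2) by auto
  have "(\<exists>n. n \<in> nodes G' \<and> (n, i) \<in> (edges G')\<^sup>* \<and> (n, j) \<in> (edges G')\<^sup>*) \<longleftrightarrow>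
        (\<exists>n. n \<in> nodes G \<and> (n, i) \<in> (edges G)\<^sup>* \<and> (n, j) \<in> (edges G)\<^sup>*)"
    (is "?L \<longleftrightarrow> ?R") if ij: "i < length (obs A)" "j < length (obs A)" for i j
  proof
    assume ?L
    then obtain n where n: "n \<in> nodes G'" "(n, i) \<in> (edges G')\<^sup>*" "(n, j) \<in> (edges G')\<^sup>*" by blast
    with up[OF n(2)] up[OF n(3)] \<pi> ij show ?R by auto
  next
    assume ?R
    then obtain n where n: "n \<in> nodes G" "(n, i) \<in> (edges G)\<^sup>*" "(n, j) \<in> (edges G)\<^sup>*" by blast
    have "(if n = P then b else n) \<in> nodes G'" using n(1) assms(3) nodes by auto
    with down[OF n(2)] down[OF n(3)] show ?L by blast
  qed
  then show ?thesis
    unfolding COH_obj_def by (intro arg_cong[where f = card]) auto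
qed

section \<open>Rank functions and the termination measure\<close>

definition increasing :: "(nat \<Rightarrow> nat) \<Rightarrow> (nat \<times> nat) set \<Rightarrow> bool" where
  "increasing d E \<longleftrightarrow> (\<forall>(x, y) \<in> E. d x < d y)"

lemma increasing_acyclic: "increasing d E \<Longrightarrow> acyclic E"
  by (rule wf_acyclic, rule wf_subset[OF wf_measure[of d]]) (auto simp: increasing_def)

lemma finite_acyclic_increasing:
  assumes "finite E" "acyclic E"
  shows "\<exists>d. increasing d E"
proof -
  \<comment> \<open>The rank is the number of proper ancestors. By acyclicity \<open>x\<close> is
    counted for \<open>y\<close> but not for itself.\<close>
  have "card {z. (z, x) \<in> E\<^sup>+} < card {z. (z, y) \<in> E\<^sup>+}" if "(x, y) \<in> E" for x y
  proof (rule psubset_card_mono)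
    have "{z. (z, y) \<in> E\<^sup>+} \<subseteq> fst ` E\<^sup>+" by force
    then show "finite {z. (z, y) \<in> E\<^sup>+}" using assms(1) by (meson finite_imageI finite_subset finite_trancl)
    have "x \<notin> {z. (z, x) \<in> E\<^sup>+}" "x \<in> {z. (z, y) \<in> E\<^sup>+}" using assms(2) that by (auto simp: acyclic_def)
    then show "{z. (z, x) \<in> E\<^sup>+} \<subset> {z. (z, y) \<in> E\<^sup>+}" using that by (auto intro: trancl_into_trancl)
  qed
  then show ?thesis by (auto simp: increasing_def intro!: exI[of _ "\<lambda>x. card {z. (z, x) \<in> E\<^sup>+}"])
qed

text \<open>A multiset, because one factoring edge may be replaced by several. The rank function is
  a parameter because it must be extended to new atoms.\<close>

definition source_ranks :: "(nat \<Rightarrow> nat) \<Rightarrow> ('p, 'v, 'c) pgraph \<Rightarrow> nat multiset" where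
  "source_ranks d G = image_mset (\<lambda>e. d (fst e)) (mset_set (factorings G))"

text \<open>Disjointness of \<open>N\<close> from the old edges turns the union of edge sets into a
  sum of multisets, as the one-step multiset order requires.\<close>

lemma source_ranks_decrease:
  assumes "finite (factorings G)" "(P, Q) \<in> factorings G" "finite N"
    and "factorings G' = factorings G - {(P, Q)} \<union> N" "N \<inter> factorings G = {}"
    and "\<And>x y. (x, y) \<in> factorings G \<Longrightarrow> d' x = d x" "\<And>x y. (x, y) \<in> N \<Longrightarrow> d' x < d P"
  shows "(source_ranks d' G', source_ranks d G) \<in> mult1 less_than"
proof (rule mult1I)
  let ?F = "factorings G"
  show "source_ranks d G = add_mset (d P) (image_mset (\<lambda>e. d (fst e)) (mset_set (?F - {(P, Q)})))"
    using assms(1,2) by (simp add: source_ranks_def mset_set.remove)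
  have "mset_set (factorings G') = mset_set (?F - {(P, Q)}) + mset_set N"
    unfolding assms(4) using assms(1,3,5) by (intro mset_set_Union) auto
  moreover have "image_mset (\<lambda>e. d' (fst e)) (mset_set (?F - {(P, Q)})) =
      image_mset (\<lambda>e. d (fst e)) (mset_set (?F - {(P, Q)}))"
    using assms(1,6) by (intro image_mset_cong) auto
  ultimately show "source_ranks d' G' = image_mset (\<lambda>e. d (fst e)) (mset_set (?F - {(P, Q)})) +
      image_mset (\<lambda>e. d' (fst e)) (mset_set N)"
    by (simp add: source_ranks_def)
  show "\<And>b. b \<in># image_mset (\<lambda>e. d' (fst e)) (mset_set N) \<Longrightarrow> (b, d P) \<in> less_than"
    using assms(3,7) by auto
qed

section \<open>The two replacements of a factoring edge\<close>

definition same_objectives ::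
  "('p, 'v, 'c) abduction \<Rightarrow> (('p, 'v, 'c) atm \<times> ('p, 'v, 'c) atm) set \<Rightarrow>
   (('p, 'v, 'c) axm \<Rightarrow> nat \<Rightarrow> real) \<Rightarrow> (('p, 'v, 'c) atm \<Rightarrow> real) \<Rightarrow>
   ('p, 'v, 'c) pgraph \<Rightarrow> ('p, 'v, 'c) pgraph \<Rightarrow> bool" where
  "same_objectives A lt w ic G G' \<longleftrightarrow>
     CARD_obj G' = CARD_obj G \<and> COH_obj A lt G' = COH_obj A lt G \<and> WA_obj A w ic G' = WA_obj A w ic G"

text \<open>As \<open>P\<close> is factored with \<open>R\<close>, its only predecessor is
  \<open>R\<close>, and the shortcuts reduce to one factoring edge from \<open>R\<close> to
  \<open>Q\<close>. No atom is added, so the rank function can be kept.\<close>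

lemma redirect_factoring:
  fixes A :: "('p, 'v, 'c) abduction" and G :: "('p, 'v, 'c) pgraph"
  assumes pg: "proof_graph A H G"
    and nonneg: "\<forall>ax \<in> axioms A. \<forall>k < length (body ax). 0 \<le> w ax k"
    and F: "(R, P) \<in> factorings G" "(P, Q) \<in> factorings G"
    and d: "increasing d (edges G)"
  shows "\<exists>H' G'. proof_graph A H' G' \<and> same_objectives A lt w ic G G' \<and>
    (\<exists>d'. increasing d' (edges G') \<and> (source_ranks d' G', source_ranks d G) \<in> mult1 less_than)"
proof -
  let ?n = "length (atoms H)"
  define F' where "F' = factorings G - {(P, Q)} \<union> {(R, Q)}"
  define G' where "G' = G\<lparr>factorings := F'\<rparr>"
  note just = proof_graph_justification[OF pg]
  have gen: "generated A H (inferences G) (factorings G)" and nodes: "nodes G = {..<?n}"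
    using pg by (simp_all add: proof_graph_def)
  have RPQ: "d R < d P" "d P < d Q" using d F by (auto simp: increasing_def edges_def)
  have old: "i < ?n \<and> j < ?n \<and> i \<noteq> j \<and> same_sorts (sorts A) (atoms H ! i) (atoms H ! j)"
    if "(i, j) \<in> factorings G" for i j
    using generated_factorings[OF gen that] .
  have new: "i < ?n \<and> j < ?n \<and> i \<noteq> j \<and> same_sorts (sorts A) (atoms H ! i) (atoms H ! j)"
    if "(i, j) \<in> F'" for i j
    using that old[OF F(1)] old[OF F(2)] old[of i j] RPQ same_sorts_trans by (auto simp: F'_def)
  obtain H0 where H0: "atoms H0 = atoms H" "generated A H0 (inferences G) {}"
    using generated_drop_factorings[OF gen] by blast
  have "finite F'" using proof_graph_finite(2)[OF pg] by (simp add: F'_def)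
  from generated_add_factorings[OF H0(2) this] new
  obtain H' where H': "atoms H' = atoms H" "generated A H' (inferences G) F'"
    unfolding H0(1) by blast
  have E': "edges G' = edges G - {(P, Q)} \<union> {(x, Q) | x. (x, P) \<in> edges G}"
  proof -
    let ?IE = "{(b, P). \<exists>ax bs. (P, ax, bs) \<in> inferences G \<and> b \<in> set bs}"
    have E: "edges G = ?IE \<union> factorings G" "edges G' = ?IE \<union> F'"
      by (simp_all add: edges_def G'_def)
    have "(x, P) \<in> edges G \<longleftrightarrow> x = R" for x
      using F(1) just(2)[OF F(1)] just(3)[OF F(1)] unfolding edges_def by blast
    then have "{(x, Q) | x. (x, P) \<in> edges G} = {(R, Q)}" by simp
    moreover have "(P, Q) \<notin> ?IE" using just(3)[OF F(2)] by blast
    ultimately show ?thesis unfolding E F'_def by blast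
  qed
  have PQ: "(P, Q) \<in> edges G" "(R, P) \<in> edges G" using F by (auto simp: edges_def)
  have inc: "increasing d (edges G')"
    using d RPQ(2) unfolding E' increasing_def by fastforce
  have "singly_justified G'"
    using just F unfolding singly_justified_def G'_def F'_def by auto
  then have pg': "proof_graph A H' G'"
    using H' nodes increasing_acyclic[OF inc] by (simp add: proof_graph_def G'_def)
  have ab: "abduced G' = abduced G"
  proof -
    have "(\<exists>b. (b, a) \<in> edges G') \<longleftrightarrow> (\<exists>b. (b, a) \<in> edges G)" for a
      using PQ unfolding E' by blast
    then show ?thesis by (simp add: abduced_def G'_def)
  qed
  have "COH_obj A lt G' = COH_obj A lt G"
  proof (rule COH_shortcut[where \<pi> = id])
    show "acyclic (edges G)" using increasing_acyclic[OF d] .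
    show "(R, P) \<in> edges G" "R \<in> nodes G" using PQ nodes old[OF F(1)] by auto
    show "(id x, id y) \<in> (edges G)\<^sup>*" if "(x, y) \<in> edges G'" for x y
      using that PQ(1) unfolding E' by (auto intro: rtrancl_into_rtrancl)
    show "edges G - {(P, Q)} \<union> {(x, Q) | x. (x, P) \<in> edges G} \<subseteq> (edges G')\<^sup>*"
      using E' by blast
  qed (simp_all add: G'_def)
  moreover have "WA_obj A w ic G' = WA_obj A w ic G"
  proof (rule WA_shortcut[OF pg pg' nonneg F(2) _ ab])
    show "P \<notin> abduced G" using PQ by (auto simp: abduced_def)
    let ?IW = "{(bs ! k, w ax k, P) | P ax bs k. (P, ax, bs) \<in> inferences G \<and> k < length bs}"
    have W: "weighted_edges w G = ?IW \<union> {(x, 1, P) | x P. (x, P) \<in> factorings G}"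
        "weighted_edges w G' = ?IW \<union> {(x, 1, P) | x P. (x, P) \<in> F'}"
      by (simp_all add: weighted_edges_def G'_def)
    have "(x, u, P) \<in> weighted_edges w G \<longleftrightarrow> x = R \<and> u = 1" for x u
      using F(1) just(2)[OF F(1)] just(3)[OF F(1)] unfolding weighted_edges_def by blast
    then have RQ: "{(x, u, Q) | x u. (x, u, P) \<in> weighted_edges w G} = {(R, 1, Q)}" by simp
    have IW: "(P, 1, Q) \<notin> ?IW" using just(3)[OF F(2)] by blast
    have FW: "{(x, 1, P) | x P. (x, P) \<in> F'} =
        {(x, 1, P) | x P. (x, P) \<in> factorings G} - {(P, 1, Q)} \<union> {(R, 1 :: real, Q)}"
      unfolding F'_def by auto
    have "X \<union> (Y - {e} \<union> Z) = X \<union> Y - {e} \<union> Z" if "e \<notin> X"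
      for X Y Z :: "(nat \<times> real \<times> nat) set" and e
      using that by blast
    from this[OF IW] have "weighted_edges w G' = weighted_edges w G - {(P, 1, Q)} \<union> {(R, 1, Q)}"
      unfolding W FW .
    with RQ show "{Min (cost A w ic G' y) * u | u y. (x, u, y) \<in> weighted_edges w G'} =
      {Min (cost A w ic G' y) * u | u y. (x, u, y) \<in> weighted_edges w G - {(P, 1, Q)} \<union>
        {(x, u, Q) | x u. (x, u, P) \<in> weighted_edges w G}}" for x by simp
  qed
  moreover have "(source_ranks d G', source_ranks d G) \<in> mult1 less_than"
  proof (rule source_ranks_decrease[OF proof_graph_finite(2)[OF pg] F(2), of "{(R, Q)}"])
    show "{(R, Q)} \<inter> factorings G = {}" using just(2)[OF F(2), of R] RPQ by auto
  qed (use RPQ in \<open>auto simp: G'_def F'_def\<close>)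
  ultimately have "same_objectives A lt w ic G G' \<and> (source_ranks d G', source_ranks d G) \<in> mult1 less_than"
    using ab by (simp add: same_objectives_def CARD_obj_def)
  then show ?thesis using pg' inc by blast
qed

text \<open>Each route from \<open>bs ! k\<close> through \<open>P\<close> to \<open>Q\<close> is
  replaced by a route through a new atom at position \<open>?n + k\<close>. With an empty body,
  \<open>P\<close> would have no incoming edge and would already be abduced.\<close>

lemma duplicate_back_chaining:
  fixes A :: "('p, 'v, 'c) abduction" and G :: "('p, 'v, 'c) pgraph"
  assumes inst: "abduction_instance A" and pg: "proof_graph A H G"
    and nonneg: "\<forall>ax \<in> axioms A. \<forall>k < length (body ax). 0 \<le> w ax k"
    and I: "(P, ax, bs) \<in> inferences G" "bs \<noteq> []"
    and F: "(P, Q) \<in> factorings G"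
    and d: "increasing d (edges G)"
  shows "\<exists>H' G'. proof_graph A H' G' \<and> same_objectives A lt w ic G G' \<and>
    (\<exists>d'. increasing d' (edges G') \<and> (source_ranks d' G', source_ranks d G) \<in> mult1 less_than)"
proof -
  let ?n = "length (atoms H)" and ?r = "length bs"
  define F' where "F' = factorings G - {(P, Q)} \<union> {(bs ! k, ?n + k) | k. k < ?r}"
  define I' where "I' = insert (Q, ax, [?n..<?n + ?r]) (inferences G)"
  define G' :: "('p, 'v, 'c) pgraph"
    where "G' = \<lparr>nodes = {..<?n + ?r}, inferences = I', factorings = F'\<rparr>"
  note just = proof_graph_justification[OF pg]
  note E_less = proof_graph_edges[OF pg]
  have gen: "generated A H (inferences G) (factorings G)" and nodes: "nodes G = {..<?n}"
    using pg by (simp_all add: proof_graph_def)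
  have obs: "length (obs A) \<le> ?n" using generated_inferences[OF gen] by simp
  have r: "0 < ?r" using I(2) by simp
  have old: "i < ?n \<and> j < ?n \<and> i \<noteq> j \<and> same_sorts (sorts A) (atoms H ! i) (atoms H ! j)"
    if "(i, j) \<in> factorings G" for i j
    using generated_factorings[OF gen that] .
  have Pn: "P < ?n" and Qn: "Q < ?n" and PQs: "same_sorts (sorts A) (atoms H ! P) (atoms H ! Q)"
    using old[OF F] by auto
  have inf_less: "P' < ?n \<and> (\<forall>k < length bs'. bs' ! k < ?n)" if "(P', ax', bs') \<in> inferences G" for P' ax' bs'
  proof -
    have "P' < ?n" "set bs' \<subseteq> {length (obs A)..<?n}"
      using proof_graph_inference[OF pg that] by (simp_all add: inference_ok_def)
    then show ?thesis by (meson atLeastLessThan_iff nth_mem subsetD)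
  qed
  obtain \<theta> where \<theta>: "unifies_head (sorts A) \<theta> (atoms H ! P) ax" "map ((!) (atoms H)) bs = body_inst ax \<theta>"
    and ax: "ax \<in> axioms A" "?r = length (body ax)"
    using proof_graph_inference[OF pg I(1)] by (auto simp: inference_ok_def simp del: map_eq_conv)
  have gr: "ground (atoms H ! P)" "ground (atoms H ! Q)"
    using generated_ground[OF gen inst nth_mem] Pn Qn by blast+
  obtain \<theta>' where \<theta>': "unifies_head (sorts A) \<theta>' (atoms H ! Q) ax"
    using unifies_head_transfer[OF \<theta>(1) PQs gr] .

  \<comment> \<open>The sequence is rebuilt: first the old back-chainings, then that of
    \<open>Q\<close>, which appends its body atoms after all old positions, and finally all
    factorings.\<close>
  obtain H0 where H0: "atoms H0 = atoms H" "generated A H0 (inferences G) {}"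
    using generated_drop_factorings[OF gen] by blast
  define H1 where "H1 = \<lparr>atoms = atoms H @ body_inst ax \<theta>', eqs = eqs H0\<rparr>"
  have lenH1: "length (atoms H1) = ?n + ?r" using ax by (simp add: H1_def body_inst_def)
  have "back_chain A H0 Q ax H1"
    using H0(1) Qn ax(1) \<theta>' by (auto simp: back_chain_def H1_def)
  from generated.back_chaining[OF H0(2) this]
  have H1: "generated A H1 I' {}" using H0(1) lenH1 by (simp add: I'_def)
  have new: "i < length (atoms H1) \<and> j < length (atoms H1) \<and> i \<noteq> j \<and>
      same_sorts (sorts A) (atoms H1 ! i) (atoms H1 ! j)" if ij: "(i, j) \<in> F'" for i j
  proof -
    consider "(i, j) \<in> factorings G" | k where "k < ?r" "i = bs ! k" "j = ?n + k"
      using ij by (auto simp: F'_def)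
    then show ?thesis
    proof cases
      case 1
      with old[OF 1] show ?thesis by (simp add: H1_def nth_append)
    next
      case 2
      have "i < ?n" using 2 inf_less[OF I(1)] by blast
      moreover have "atoms H ! i = body_inst ax \<theta> ! k" using 2 \<theta>(2) by (metis nth_map)
      moreover have "same_sorts (sorts A) (body_inst ax \<theta> ! k) (body_inst ax \<theta>' ! k)"
        using body_inst_same_sorts[OF \<theta>(1) \<theta>' PQs gr] 2 ax by simp
      ultimately show ?thesis using 2 lenH1 by (simp add: H1_def nth_append)
    qed
  qed
  have "finite F'" using proof_graph_finite(2)[OF pg] by (simp add: F'_def)
  from generated_add_factorings[OF H1 this new]
  obtain H' where H': "atoms H' = atoms H1" "generated A H' I' F'" by blast

  have E': "(x, y) \<in> edges G' \<longleftrightarrow> (x, y) \<in> edges G \<and> (x, y) \<noteq> (P, Q) \<or>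
      (\<exists>k < ?r. x = bs ! k \<and> y = ?n + k) \<or> (\<exists>k < ?r. x = ?n + k \<and> y = Q)" for x y
  proof -
    have "x \<in> set [?n..<?n + ?r] \<longleftrightarrow> (\<exists>k < ?r. x = ?n + k)"
      by (auto simp: le_iff_add)
    then show ?thesis
      using just(3)[OF F] unfolding edges_def G'_def F'_def I'_def by auto
  qed
  have P_inf: "(P, ax', bs') \<in> inferences G \<longleftrightarrow> ax' = ax \<and> bs' = bs" for ax' bs'
    using just(1)[OF I(1), of "(ax', bs')"] I(1) by auto
  have P_fac: "(x, P) \<notin> factorings G" for x
    using just(3)[of x P "(ax, bs)"] I(1) by blast
  have EP: "(x, P) \<in> edges G \<longleftrightarrow> (\<exists>k < ?r. x = bs ! k)" for x
    by (auto simp: edges_def P_inf P_fac in_set_conv_nth)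
  have PQ: "(P, Q) \<in> edges G" using F by (auto simp: edges_def)
  \<comment> \<open>New atoms lie between \<open>bs ! k\<close> and \<open>Q\<close>, as
    \<open>P\<close> did, so they inherit its rank.\<close>
  define d' where "d' x = (if x < ?n then d x else d P)" for x
  have dP: "d (bs ! k) < d P" if "k < ?r" for k using d EP that by (auto simp: increasing_def)
  have inc: "increasing d' (edges G')"
  proof -
    have "d' x < d' y" if xy: "(x, y) \<in> edges G'" for x y
    proof -
      consider "(x, y) \<in> edges G" | k where "k < ?r" "x = bs ! k" "y = ?n + k"
        | k where "k < ?r" "x = ?n + k" "y = Q" using xy E' by blast
      then show ?thesis
      proof cases
        case 1
        then show ?thesis using d E_less[OF 1] by (auto simp: increasing_def d'_def)
      next
        case 2
        then show ?thesis using dP inf_less[OF I(1)] by (simp add: d'_def)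
      next
        case 3
        then show ?thesis using d PQ Qn by (auto simp: increasing_def d'_def)
      qed
    qed
    then show ?thesis by (auto simp: increasing_def)
  qed
  \<comment> \<open>\<open>Q\<close> exchanges its factoring for an inference. A new atom is the
    target of just one factoring, and its position is too large for it to be back-chained.\<close>
  have "singly_justified G'"
  proof -
    have "x = y" if "(R, x) \<in> I'" "(R, y) \<in> I'" for R x y
      using that just(1)[of R x y] just(3)[OF F] unfolding I'_def by (cases x; cases y) auto
    moreover have "R = R'" if "(R, S) \<in> F'" "(R', S) \<in> F'" for R R' S
      using that just(2)[of R S R'] old[of R S] old[of R' S] unfolding F'_def by auto
    moreover have "\<not> ((S, x) \<in> I' \<and> (R, S) \<in> F')" for S x R
      using just(2)[OF F, of R] just(3)[of R S x] old[of R S] Qn inf_less[of S "fst x" "snd x"]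
      unfolding I'_def F'_def by (cases x) auto
    ultimately show ?thesis
      unfolding singly_justified_def G'_def by simp blast
  qed
  then have pg': "proof_graph A H' G'"
    using H' lenH1 increasing_acyclic[OF inc] by (simp add: proof_graph_def G'_def)
  \<comment> \<open>Every new atom is factored with some \<open>bs ! k\<close>, and the nonempty
    body keeps \<open>Q\<close> justified.\<close>
  have ab: "abduced G' = abduced G"
  proof -
    have "(\<exists>b. (b, a) \<in> edges G') \<longleftrightarrow> (\<exists>b. (b, a) \<in> edges G)" if "a < ?n" for a
    proof (cases "a = Q")
      case True
      then show ?thesis using E'[of "?n + 0" Q] PQ r by auto
    next
      case False
      then show ?thesis using E'[of _ a] that by auto
    qed
    moreover have "\<exists>b. (b, a) \<in> edges G'" if "a < ?n + ?r" "\<not> a < ?n" for a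
    proof -
      have "a - ?n < ?r" "a = ?n + (a - ?n)" using that by simp_all
      then show ?thesis using E' by blast
    qed
    moreover have "nodes G' = {..<?n + ?r}" by (simp add: G'_def)
    ultimately show ?thesis
      unfolding abduced_def nodes by (metis (lifting) lessThan_iff trans_less_add1)
  qed
  have "COH_obj A lt G' = COH_obj A lt G"
  proof (rule COH_shortcut[where \<pi> = "\<lambda>x. if x < ?n then x else P"])
    \<comment> \<open>\<open>\<pi>\<close> maps the duplicated body atoms to \<open>P\<close>, whose position between \<open>bs\<close> and \<open>Q\<close> they take over.\<close>
    show "acyclic (edges G)" using increasing_acyclic[OF d] .
    show "(bs ! 0, P) \<in> edges G" using EP r by blast
    then show "bs ! 0 \<in> nodes G" using E_less nodes by blast
    show "(if x < ?n then x else P, if y < ?n then y else P) \<in> (edges G)\<^sup>*" if xy: "(x, y) \<in> edges G'" for x y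
    proof -
      consider "(x, y) \<in> edges G" | k where "k < ?r" "x = bs ! k" "y = ?n + k"
        | k where "k < ?r" "x = ?n + k" "y = Q" using xy E' by blast
      then show ?thesis
      proof cases
        case 1
        then show ?thesis using E_less[OF 1] by auto
      next
        case 2
        then have "(x, P) \<in> edges G" using EP by blast
        then show ?thesis using 2 E_less(1) by auto
      next
        case 3
        then show ?thesis using PQ Qn by auto
      qed
    qed
    show "edges G - {(P, Q)} \<union> {(x, Q) | x. (x, P) \<in> edges G} \<subseteq> (edges G')\<^sup>*"
    proof -
      have "(bs ! k, Q) \<in> (edges G')\<^sup>*" if "k < ?r" for k
      proof -
        have "(bs ! k, ?n + k) \<in> edges G'" "(?n + k, Q) \<in> edges G'" using E' that by blast+
        then show ?thesis by (meson r_into_rtrancl rtrancl_into_rtrancl)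
      qed
      moreover have "edges G - {(P, Q)} \<subseteq> edges G'" using E' by auto
      ultimately show ?thesis using EP by auto
    qed
  qed (use obs Pn in \<open>auto simp: G'_def nodes\<close>)
  moreover have "WA_obj A w ic G' = WA_obj A w ic G"
  proof (rule WA_shortcut[OF pg pg' nonneg F _ ab])
    show "P \<notin> abduced G" using EP r by (auto simp: abduced_def)
    let ?W = "weighted_edges w G" and ?m = "\<lambda>y. Min (cost A w ic G' y)"
    have WP: "(x, u, P) \<in> ?W \<longleftrightarrow> (\<exists>k < ?r. x = bs ! k \<and> u = w ax k)" for x u
      by (auto simp: weighted_edges_def P_inf P_fac)
    have W': "(x, u, y) \<in> weighted_edges w G' \<longleftrightarrow> (x, u, y) \<in> ?W \<and> (x, u, y) \<noteq> (P, 1, Q) \<or>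
      (\<exists>k < ?r. x = bs ! k \<and> u = 1 \<and> y = ?n + k) \<or> (\<exists>k < ?r. x = ?n + k \<and> u = w ax k \<and> y = Q)" for x u y
    proof -
      let ?old = "\<exists>ax' bs' k. (y, ax', bs') \<in> inferences G \<and> k < length bs' \<and> x = bs' ! k \<and> u = w ax' k"
      have old: "(x, u, y) \<in> ?W \<longleftrightarrow> ?old \<or> u = 1 \<and> (x, y) \<in> factorings G"
        unfolding weighted_edges_def by blast
      have "(\<exists>ax' bs' k. (y, ax', bs') \<in> I' \<and> k < length bs' \<and> x = bs' ! k \<and> u = w ax' k) \<longleftrightarrow>
          ?old \<or> (\<exists>k < ?r. x = ?n + k \<and> u = w ax k \<and> y = Q)"
      proof -
        have "(\<exists>k < length [?n..<?n + ?r]. x = [?n..<?n + ?r] ! k \<and> u = w ax k) \<longleftrightarrow>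
            (\<exists>k < ?r. x = ?n + k \<and> u = w ax k)" by auto
        then show ?thesis unfolding I'_def by blast
      qed
      then have "(x, u, y) \<in> weighted_edges w G' \<longleftrightarrow>
          ?old \<or> (\<exists>k < ?r. x = ?n + k \<and> u = w ax k \<and> y = Q) \<or> u = 1 \<and> (x, y) \<in> F'"
        unfolding weighted_edges_def G'_def pgraph.simps by blast
      moreover have "(x, y) \<in> F' \<longleftrightarrow> (x, y) \<in> factorings G \<and> (x, y) \<noteq> (P, Q) \<or>
          (\<exists>k < ?r. x = bs ! k \<and> y = ?n + k)"
        unfolding F'_def by blast
      moreover have "\<not> ?old" if "y = Q" using just(3)[OF F] that by blast
      ultimately show ?thesis unfolding old by blast
    qed
    have W_less: "x < ?n" if "(x, u, y) \<in> ?W" for x u y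
      using that E_less edges_eq_weighted by blast
    \<comment> \<open>The only edge leaving a new atom is the back-chaining edge to
      \<open>Q\<close>. Factoring passes this cost on to \<open>bs ! k\<close> with weight 1, which
      is the contribution of the shortcut from \<open>bs ! k\<close> to \<open>Q\<close> with weight
      \<open>w ax k\<close>.\<close>
    have cost_new: "?m (?n + k) = ?m Q * w ax k" if "k < ?r" for k
    proof -
      have "(?n + k, u, y) \<in> weighted_edges w G' \<longleftrightarrow> u = w ax k \<and> y = Q" for u y
      proof -
        have "(?n + k, u, y) \<notin> ?W" using W_less[of "?n + k" u y] by auto
        moreover have "?n + k \<noteq> bs ! k'" if "k' < ?r" for k' using inf_less[OF I(1)] that by force
        ultimately show ?thesis unfolding W' using that by auto
      qed
      then have "cost A w ic G' (?n + k) = {?m Q * w ax k}"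
        using cost_eq[OF pg', of w ic "?n + k"] obs by simp
      then show ?thesis by simp
    qed
    fix x assume "x < ?n"
    show "{?m y * u | u y. (x, u, y) \<in> weighted_edges w G'} =
      {?m y * u | u y. (x, u, y) \<in> ?W - {(P, 1, Q)} \<union> {(x, u, Q) | x u. (x, u, P) \<in> ?W}}"
      (is "?L = ?R")
    proof (intro subset_antisym subsetI)
      fix c assume "c \<in> ?L"
      then obtain u y where c: "c = ?m y * u" "(x, u, y) \<in> weighted_edges w G'" by blast
      then consider "(x, u, y) \<in> ?W - {(P, 1, Q)}" | k where "k < ?r" "x = bs ! k" "u = 1" "y = ?n + k"
        using W' \<open>x < ?n\<close> by auto
      then show "c \<in> ?R"
      proof cases
        case 2
        then have "c = ?m Q * w ax k" "(x, w ax k, P) \<in> ?W" using c cost_new WP by auto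
        then show ?thesis by blast
      qed (use c in blast)
    next
      fix c assume "c \<in> ?R"
      then obtain u y where c: "c = ?m y * u" "(x, u, y) \<in> ?W - {(P, 1, Q)} \<or> y = Q \<and> (x, u, P) \<in> ?W" by blast
      then consider "(x, u, y) \<in> ?W - {(P, 1, Q)}" | k where "k < ?r" "x = bs ! k" "u = w ax k" "y = Q"
        using WP by blast
      then show "c \<in> ?L"
      proof cases
        case 1
        then have "(x, u, y) \<in> weighted_edges w G'" using W' by blast
        with c show ?thesis by blast
      next
        case 2
        then have "c = ?m (?n + k) * 1" "(x, 1, ?n + k) \<in> weighted_edges w G'"
          using c cost_new W' by auto
        then show ?thesis by blast
      qed
    qed
  qed
  moreover have "(source_ranks d' G', source_ranks d G) \<in> mult1 less_than"
  proof (rule source_ranks_decrease[OF proof_graph_finite(2)[OF pg] F])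
    show "factorings G' = factorings G - {(P, Q)} \<union> {(bs ! k, ?n + k) | k. k < ?r}"
      by (simp add: G'_def F'_def)
    show "{(bs ! k, ?n + k) | k. k < ?r} \<inter> factorings G = {}" using old by fastforce
  qed (use old dP inf_less[OF I(1)] in \<open>auto simp: d'_def\<close>)
  ultimately have "same_objectives A lt w ic G G' \<and> (source_ranks d' G', source_ranks d G) \<in> mult1 less_than"
    using ab by (simp add: same_objectives_def CARD_obj_def)
  then show ?thesis using pg' inc by blast
qed

section \<open>Termination of the replacements\<close>

lemma factoring_step:
  fixes A :: "('p, 'v, 'c) abduction" and G :: "('p, 'v, 'c) pgraph"
  assumes "abduction_instance A" "proof_graph A H G"
    and "\<forall>ax \<in> axioms A. \<forall>k < length (body ax). 0 \<le> w ax k"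
    and d: "increasing d (edges G)"
    and "\<not> factors_only_with_abduced G"
  shows "\<exists>H' G'. proof_graph A H' G' \<and> same_objectives A lt w ic G G' \<and>
    (\<exists>d'. increasing d' (edges G') \<and> (source_ranks d' G', source_ranks d G) \<in> mult1 less_than)"
proof -
  obtain P Q where PQ: "(P, Q) \<in> factorings G" "P \<notin> abduced G"
    using assms(5) by (auto simp: factors_only_with_abduced_def)
  then have "(P, Q) \<in> edges G" by (simp add: edges_def)
  then have "P \<in> nodes G" using proof_graph_edges[OF assms(2)] assms(2) by (auto simp: proof_graph_def)
  with PQ(2) obtain b where "(b, P) \<in> edges G" by (auto simp: abduced_def)
  then consider "(b, P) \<in> factorings G" | ax bs where "(P, ax, bs) \<in> inferences G" "b \<in> set bs"
    by (auto simp: edges_def)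
  then show ?thesis
  proof cases
    case 1
    show ?thesis by (rule redirect_factoring[OF assms(2,3) 1 PQ(1) d])
  next
    case 2
    then have "bs \<noteq> []" by auto
    show ?thesis by (rule duplicate_back_chaining[OF assms(1,2,3) 2(1) \<open>bs \<noteq> []\<close> PQ(1) d])
  qed
qed

lemma factoring_elimination:
  fixes A :: "('p, 'v, 'c) abduction" and G :: "('p, 'v, 'c) pgraph"
  assumes inst: "abduction_instance A"
    and nonneg: "\<forall>ax \<in> axioms A. \<forall>k < length (body ax). 0 \<le> w ax k"
    and "proof_graph A H G" "increasing d (edges G)"
  shows "\<exists>H' G'. proof_graph A H' G' \<and> same_objectives A lt w ic G G' \<and> factors_only_with_abduced G'"
proof -
  have "wf (mult (less_than :: nat rel))" by (intro wf_mult wf_less_than)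
  then show ?thesis using assms(3,4)
  \<comment> \<open>The rank function is generalised as well, since each replacement may come with
    its own extension of it.\<close>
  proof (induction "source_ranks d G" arbitrary: d H G rule: wf_induct_rule)
    case less
    show ?case
    proof (cases "factors_only_with_abduced G")
      case True
      with less.prems show ?thesis by (auto simp: same_objectives_def)
    next
      case False
      from factoring_step[OF inst less.prems(1) nonneg less.prems(2) False, where lt = lt and ic = ic]
      obtain H1 G1 d1 where 1: "proof_graph A H1 G1" "same_objectives A lt w ic G G1"
        "increasing d1 (edges G1)" "(source_ranks d1 G1, source_ranks d G) \<in> mult1 less_than" by blast
      from 1(4) have "(source_ranks d1 G1, source_ranks d G) \<in> mult less_than"
        by (auto simp: mult_def)
      from less.hyps[OF this 1(1,3)] 1(2) show ?thesis by (auto simp: same_objectives_def)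
    qed
  qed
qed

theorem proposition2:
  fixes A :: "('p, 'v, 'c) abduction"
    and H :: "('p, 'v, 'c) hypothesis"
    and G :: "('p, 'v, 'c) pgraph"
    and lt :: "(('p, 'v, 'c) atm \<times> ('p, 'v, 'c) atm) set"
    and w :: "('p, 'v, 'c) axm \<Rightarrow> nat \<Rightarrow> real"
    and ic :: "('p, 'v, 'c) atm \<Rightarrow> real"
  assumes "abduction_instance A"
    and "H \<in> hypotheses A"
    and "proof_graph A H G"
    and "strict_linear_order_on (set (obs A)) lt"
    and "\<And>ax k. ax \<in> axioms A \<Longrightarrow> k < length (body ax) \<Longrightarrow> 0 \<le> w ax k"
  shows "\<exists>H' \<in> hypotheses A. \<exists>G'.
           proof_graph A H' G' \<and>
           CARD_obj G' = CARD_obj G \<and>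
           COH_obj A lt G' = COH_obj A lt G \<and>
           WA_obj A w ic G' = WA_obj A w ic G \<and>
           factors_only_with_abduced G'"
proof -
  obtain d where "increasing d (edges G)"
    using finite_acyclic_increasing proof_graph_finite(3)[OF assms(3)] assms(3)
    by (auto simp: proof_graph_def)
  moreover have "\<forall>ax \<in> axioms A. \<forall>k < length (body ax). 0 \<le> w ax k" using assms(5) by blast
  ultimately obtain H' G' where "proof_graph A H' G'" "same_objectives A lt w ic G G'"
    "factors_only_with_abduced G'"
    using factoring_elimination[OF assms(1) _ assms(3), where lt = lt and ic = ic] by blast
  moreover from this have "H' \<in> hypotheses A"
    using generated_imp_hypothesis by (auto simp: proof_graph_def)
  ultimately show ?thesis unfolding same_objectives_def by blast
qed

end
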